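(* For all $k \ge 4$ and $n \ge k+3$, $$\mathrm{sat}^\ast(n,T_k^* ) = \mathrm{sat}(n,T_{k+1}^* ) = n-\left\lfloor\frac{n+k-1}{k+1}\right\rfloor.$$
   Context: All graphs are finite and simple. For $k\ge 4$, $T_k^*$ is the tree on $k$ vertices obtained by subdividing one edge of the star $K_{1,k-2}$ (once). A graph $G$ is $H$-saturated if $G$ has no subgraph isomorphic to $H$, but adding any non-edge to $G$ creates a subgraph isomorphic to $H$; $\mathrm{sat}(n,H)$ is the minimum number of edges in an $H$-saturated graph on $n$ vertices. An edge-colouring of a graph is proper if any two distinct edges sharing a vertex receive different colours. A rainbow copy of $H$ in an edge-coloured graph $G$ is a subgraph of $G$ isomorphic to $H$ all of whose edges have distinct colours. A graph $G$ is properly rainbow $H$-saturated if (1) there is a proper edge-colouring of $G$ containing no rainbow copy of $H$, and (2) for every non-edge $e \notin E(G)$ (a pair of distinct non-adjacent vertices of $G$), every proper edge-colouring of $G+e$ contains a rainbow copy of $H$. The proper rainbow saturation number $\mathrm{sat}^\ast(n,H)$ is the minimum number of edges in a properly rainbow $H$-saturated graph on $n$ vertices. *)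

theory Defs
  imports Main
begin

datatype 'a sgraph = SGraph (verts: "'a set") (edges: "'a set set")

definition simple_graph :: "'a sgraph \<Rightarrow> bool" where
  "simple_graph G \<longleftrightarrow>
     finite (verts G) \<and> (\<forall>e\<in>edges G. e \<subseteq> verts G \<and> card e = 2)"

definition subgraph :: "'a sgraph \<Rightarrow> 'a sgraph \<Rightarrow> bool" where
  "subgraph F G \<longleftrightarrow>
     simple_graph F \<and> verts F \<subseteq> verts G \<and> edges F \<subseteq> edges G"

definition graph_iso :: "'a sgraph \<Rightarrow> 'b sgraph \<Rightarrow> bool" where
  "graph_iso G H \<longleftrightarrow>
     (\<exists>f. bij_betw f (verts G) (verts H) \<and> edges H = (\<lambda>e. f ` e) ` edges G)"

definition non_edges :: "'a sgraph \<Rightarrow> 'a set set" where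
  "non_edges G = {e. e \<subseteq> verts G \<and> card e = 2 \<and> e \<notin> edges G}"

definition add_edge :: "'a sgraph \<Rightarrow> 'a set \<Rightarrow> 'a sgraph" where
  "add_edge G e = SGraph (verts G) (insert e (edges G))"

definition contains_copy :: "'b sgraph \<Rightarrow> 'a sgraph \<Rightarrow> bool" where
  "contains_copy H G \<longleftrightarrow> (\<exists>F. subgraph F G \<and> graph_iso H F)"

definition saturated :: "'b sgraph \<Rightarrow> 'a sgraph \<Rightarrow> bool" where
  "saturated H G \<longleftrightarrow>
     \<not> contains_copy H G \<and> (\<forall>e\<in>non_edges G. contains_copy H (add_edge G e))"

definition proper_edge_colouring :: "('a set \<Rightarrow> 'c) \<Rightarrow> 'a sgraph \<Rightarrow> bool" where
  "proper_edge_colouring c G \<longleftrightarrow>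
     (\<forall>e\<in>edges G. \<forall>e'\<in>edges G. e \<noteq> e' \<and> e \<inter> e' \<noteq> {} \<longrightarrow> c e \<noteq> c e')"

definition contains_rainbow_copy ::
    "('a set \<Rightarrow> 'c) \<Rightarrow> 'b sgraph \<Rightarrow> 'a sgraph \<Rightarrow> bool" where
  "contains_rainbow_copy c H G \<longleftrightarrow>
     (\<exists>F. subgraph F G \<and> graph_iso H F \<and> inj_on c (edges F))"

text \<open>Colours are natural numbers: no bound on the number of colours is imposed, and a
  finite graph only ever uses finitely many of them.\<close>

definition properly_rainbow_saturated :: "'b sgraph \<Rightarrow> 'a sgraph \<Rightarrow> bool" where
  "properly_rainbow_saturated H G \<longleftrightarrow>
     (\<exists>c :: 'a set \<Rightarrow> nat. proper_edge_colouring c G \<and> \<not> contains_rainbow_copy c H G) \<and>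
     (\<forall>e\<in>non_edges G. \<forall>c :: 'a set \<Rightarrow> nat.
        proper_edge_colouring c (add_edge G e) \<longrightarrow> contains_rainbow_copy c H (add_edge G e))"

text \<open>Every graph on \<open>n\<close> vertices is isomorphic to one whose vertices are natural numbers.\<close>

definition sat :: "nat \<Rightarrow> 'b sgraph \<Rightarrow> nat" where
  "sat n H = (LEAST m. \<exists>G :: nat sgraph. simple_graph G \<and> card (verts G) = n \<and>
     saturated H G \<and> card (edges G) = m)"

definition proper_rainbow_sat :: "nat \<Rightarrow> 'b sgraph \<Rightarrow> nat" where
  "proper_rainbow_sat n H = (LEAST m. \<exists>G :: nat sgraph. simple_graph G \<and> card (verts G) = n \<and>
     properly_rainbow_saturated H G \<and> card (edges G) = m)"

text \<open>The star \<open>K\<^bsub>1,m\<^esub>\<close> with centre \<open>0\<close> and leaves \<open>1, \<dots>, m\<close>.\<close>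

definition star :: "nat \<Rightarrow> nat sgraph" where
  "star m = SGraph {0..m} {{0, i} | i. i \<in> {1..m}}"

text \<open>\<open>w\<close> is the subdividing vertex; it is meant to lie outside \<open>verts G\<close>.\<close>

definition subdivide_edge :: "'a sgraph \<Rightarrow> 'a set \<Rightarrow> 'a \<Rightarrow> 'a sgraph" where
  "subdivide_edge G e w =
     SGraph (insert w (verts G)) ((edges G - {e}) \<union> {{u, w} | u. u \<in> e})"

text \<open>\<open>T\<^sub>k\<^sup>*\<close>, for \<open>k \<ge> 4\<close>; by symmetry of the star it does not matter
  which edge is subdivided.\<close>

definition T_star :: "nat \<Rightarrow> nat sgraph" where
  "T_star k = subdivide_edge (star (k - 2)) {0, 1} (k - 1)"

end

theory Submission
  imports Defs
begin

text \<open>A copy of \<open>T\<^bsub>k+1\<^esub>\<^sup>*\<close> contains, under every proper colouring, a rainbow copy of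
  \<open>T\<^sub>k\<^sup>*\<close>, as at most one edge at its centre repeats the colour of the pendant edge.
  Hence a graph without a copy of \<open>T\<^sub>k\<^sup>*\<close> in which every new edge creates a copy of
  \<open>T\<^bsub>k+1\<^esub>\<^sup>*\<close> settles the upper bound for both numbers. Such a graph is the
  disjoint union of a single edge and stars with at least \<open>k\<close> leaves.

  For the lower bound, call a component a tree if it has fewer edges than vertices. In a saturated
  graph, tree components on at most \<open>k\<close> vertices have at most two vertices, there is at most one
  of these, and an isolated vertex excludes any other tree component. If there are \<open>t \<ge> 2\<close> trees,
  they therefore have at least \<open>2 + (t - 1)(k + 1)\<close> vertices in total, which bounds \<open>t\<close>; the number of edges
  is at least \<open>n - t\<close>.\<close>

section \<open>Copies of the subdivided star\<close>

text \<open>Graphs are reduced to their edge sets, which suffices for copies because the subdivided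
  star has no isolated vertices.\<close>

definition edge_set :: "'a set set \<Rightarrow> bool" where
  "edge_set E \<longleftrightarrow> finite E \<and> (\<forall>e\<in>E. card e = 2)"

definition neighbours :: "'a set set \<Rightarrow> 'a \<Rightarrow> 'a set" where
  "neighbours E v = {x. {v, x} \<in> E}"

text \<open>The subdivided star with centre \<open>v\<close>, subdividing vertex \<open>u\<close>,
  far end \<open>w\<close> and remaining leaves \<open>L\<close>. With \<open>card L = k - 3\<close>
  it has \<open>k\<close> vertices.\<close>

definition T_edges :: "'a \<Rightarrow> 'a \<Rightarrow> 'a \<Rightarrow> 'a set \<Rightarrow> 'a set set" where
  "T_edges v u w L = insert {v, u} (insert {u, w} ((\<lambda>x. {v, x}) ` L))"

definition T_shape :: "'a \<Rightarrow> 'a \<Rightarrow> 'a \<Rightarrow> 'a set \<Rightarrow> bool" where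
  "T_shape v u w L \<longleftrightarrow> v \<noteq> u \<and> v \<noteq> w \<and> u \<noteq> w \<and> finite L \<and> v \<notin> L \<and> u \<notin> L \<and> w \<notin> L"

lemma edge_setD: "edge_set E \<Longrightarrow> finite E" "edge_set E \<Longrightarrow> e \<in> E \<Longrightarrow> card e = 2"
  by (auto simp: edge_set_def)

lemma edge_set_subset: "edge_set E \<Longrightarrow> F \<subseteq> E \<Longrightarrow> edge_set F"
  by (auto simp: edge_set_def intro: finite_subset)

lemma edge_set_insert: "edge_set E \<Longrightarrow> x \<noteq> y \<Longrightarrow> edge_set (insert {x, y} E)"
  by (auto simp: edge_set_def)

lemma edge_set_neq: "edge_set E \<Longrightarrow> {x, y} \<in> E \<Longrightarrow> x \<noteq> y"
  using edge_setD(2) by fastforce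

lemma edge_setE:
  assumes "edge_set E" "e \<in> E"
  obtains x y where "e = {x, y}" "x \<noteq> y"
  using assms edge_setD(2) card_2_iff by metis

lemma edge_set_at:
  assumes "edge_set E" "e \<in> E" "p \<in> e"
  obtains q where "e = {p, q}" "p \<noteq> q" "q \<in> neighbours E p"
proof -
  obtain x y where xy: "e = {x, y}" "x \<noteq> y" using edge_setE[OF assms(1,2)] .
  show ?thesis
  proof (cases "p = x")
    case True
    then show ?thesis using that[of y] xy assms(2) by (simp add: neighbours_def)
  next
    case False
    then have "p = y" using assms(3) xy by simp
    then show ?thesis using that[of x] xy assms(2) by (simp add: neighbours_def insert_commute)
  qed
qed

lemma finite_Union_edge_set: "edge_set E \<Longrightarrow> finite (\<Union>E)"
  by (metis edge_setD card.infinite finite_Union zero_neq_numeral)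

lemma finite_neighbours: "edge_set E \<Longrightarrow> finite (neighbours E v)"
  by (rule finite_subset[OF _ finite_Union_edge_set]) (auto simp: neighbours_def)

lemma in_neighbours: "x \<in> neighbours E v \<longleftrightarrow> {v, x} \<in> E"
  by (simp add: neighbours_def)

lemma neighbours_sym: "x \<in> neighbours E v \<Longrightarrow> v \<in> neighbours E x"
  by (simp add: neighbours_def insert_commute)

lemma T_edges_subset_iff:
  "T_edges v u w L \<subseteq> E \<longleftrightarrow> {v, u} \<in> E \<and> {u, w} \<in> E \<and> (\<forall>x\<in>L. {v, x} \<in> E)"
  by (auto simp: T_edges_def)

lemma card_T_edges:
  assumes "T_shape v u w L"
  shows "card (T_edges v u w L) = card L + 2"
proof -
  have "inj_on (\<lambda>x. {v, x}) L"
    by (auto simp: inj_on_def doubleton_eq_iff)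
  then have "card ((\<lambda>x. {v, x}) ` L) = card L" by (rule card_image)
  then show ?thesis
    using assms unfolding T_edges_def T_shape_def
    by (subst card_insert_disjoint; (subst card_insert_disjoint)?) (auto simp: doubleton_eq_iff)
qed

lemma simple_graph_edge_set: "simple_graph G \<Longrightarrow> edge_set (edges G)"
  unfolding simple_graph_def edge_set_def
  by (meson Pow_iff finite_Pow_iff finite_subset subsetI)

lemma verts_T_star: "k \<ge> 4 \<Longrightarrow> verts (T_star k) = {0, k - 1, 1} \<union> {2..k - 2}"
  by (auto simp: T_star_def subdivide_edge_def star_def)

lemma edges_T_star:
  assumes "k \<ge> 4"
  shows "edges (T_star k) = T_edges 0 (k - 1) 1 {2..k - 2}"
proof -
  have "{{0, i} |i. i \<in> {1..k - 2}} - {{0, 1}} = (\<lambda>x. {0, x}) ` {2..k - 2}"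
  proof -
    have *: "i \<in> {2..k - 2} \<longleftrightarrow> i \<in> {1..k - 2} \<and> i \<noteq> 1" for i by auto
    have "{0, i} = {0, 1} \<longleftrightarrow> i = 1" for i :: nat by (auto simp: doubleton_eq_iff)
    then show ?thesis using * by fastforce
  qed
  moreover have "{{u, k - 1} |u. u \<in> {0, 1}} = {{0, k - 1}, {k - 1, 1}}" by (auto simp: insert_commute)
  ultimately show ?thesis
    by (auto simp: T_star_def subdivide_edge_def star_def T_edges_def)
qed

lemma image_T_edges: "(`) f ` T_edges v u w L = T_edges (f v) (f u) (f w) (f ` L)"
  by (auto simp: T_edges_def image_image)

text \<open>Frees later arguments from isomorphisms: a copy is given by the images of the centre, of
  the two path vertices and of the other leaves. The predicate \<open>Q\<close> covers plain copies
  (\<open>True\<close>) as well as rainbow ones (\<open>inj_on c\<close>).\<close>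

lemma T_star_copy_iff:
  assumes "simple_graph G" "k \<ge> 4"
  shows "(\<exists>F. subgraph F G \<and> graph_iso (T_star k) F \<and> Q (edges F)) \<longleftrightarrow>
    (\<exists>v u w L. T_shape v u w L \<and> card L = k - 3 \<and> T_edges v u w L \<subseteq> edges G \<and> Q (T_edges v u w L))"
    (is "?l \<longleftrightarrow> ?r")
proof
  assume ?l
  then obtain F f where F: "subgraph F G" "Q (edges F)" and
    f: "bij_betw f (verts (T_star k)) (verts F)" "edges F = (\<lambda>e. f ` e) ` edges (T_star k)"
    by (auto simp: graph_iso_def)
  let ?L = "f ` {2..k - 2}"
  have inj: "inj_on f ({0, k - 1, 1} \<union> {2..k - 2})"
    using f(1) assms(2) verts_T_star by (simp add: bij_betw_def)
  have e: "edges F = T_edges (f 0) (f (k - 1)) (f 1) ?L"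
    using f(2) edges_T_star[OF assms(2)] image_T_edges by metis
  have "T_shape (f 0) (f (k - 1)) (f 1) ?L"
    unfolding T_shape_def using assms(2)
    by (auto simp: inj_on_eq_iff[OF inj] dest!: inj_onD[OF inj])
  moreover have "card ?L = k - 3"
    by (subst card_image) (use inj assms in \<open>auto intro: inj_on_subset\<close>)
  ultimately show ?r using F e unfolding subgraph_def by metis
next
  assume ?r
  then obtain v u w L where T: "T_shape v u w L" "card L = k - 3"
    "T_edges v u w L \<subseteq> edges G" "Q (T_edges v u w L)" by auto
  have "finite L" using T by (simp add: T_shape_def)
  moreover have "card {2..k - 2} = card L" using T assms by auto
  ultimately obtain g where g: "bij_betw g {2..k - 2} L"
    using finite_same_card_bij by blast
  \<comment> \<open>In \<open>T_star k\<close> the centre is \<open>0\<close>, the subdividing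
    vertex is \<open>k - 1\<close> and its other neighbour is \<open>1\<close>.\<close>
  define f where "f = g(0 := v, k - 1 := u, 1 := w)"
  let ?F = "SGraph ({v, u, w} \<union> L) (T_edges v u w L)"
  have f: "f 0 = v" "f (k - 1) = u" "f 1 = w" using assms(2) by (auto simp: f_def)
  have fg: "f x = g x" if "x \<in> {2..k - 2}" for x
    using that assms(2) by (auto simp: f_def)
  have fL: "bij_betw f {2..k - 2} L"
    using g fg bij_betw_cong[of "{2..k - 2}" f g L] by blast
  have "inj_on f {0, k - 1, 1}"
    using T(1) f by (auto simp: T_shape_def inj_on_def)
  then have "bij_betw f {0, k - 1, 1} {v, u, w}"
    using f by (auto simp: bij_betw_def)
  then have b: "bij_betw f (verts (T_star k)) ({v, u, w} \<union> L)"
    unfolding verts_T_star[OF assms(2)]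
    using T(1) by (intro bij_betw_combine fL) (auto simp: T_shape_def)
  have "edges ?F = (\<lambda>e. f ` e) ` edges (T_star k)"
    using fL f by (simp add: edges_T_star[OF assms(2)] image_T_edges bij_betw_def)
  then have "graph_iso (T_star k) ?F"
    using b by (auto simp: graph_iso_def)
  moreover have "subgraph ?F G"
  proof -
    have "\<forall>e\<in>edges G. e \<subseteq> verts G \<and> card e = 2" using assms(1) by (simp add: simple_graph_def)
    then have "\<forall>e\<in>T_edges v u w L. e \<subseteq> verts G \<and> card e = 2" using T(3) by blast
    moreover have "\<Union>(T_edges v u w L) = {v, u, w} \<union> L" by (auto simp: T_edges_def)
    moreover have "finite ({v, u, w} \<union> L)" using T(1) by (simp add: T_shape_def)
    ultimately show ?thesis
      using T(3) unfolding subgraph_def simple_graph_def sgraph.sel by blast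
  qed
  ultimately show ?l using T(4) by (intro exI[of _ ?F]) simp
qed

section \<open>Avoiding the subdivided star\<close>

definition avoids_T :: "nat \<Rightarrow> 'a set set \<Rightarrow> bool" where
  "avoids_T k E \<longleftrightarrow> \<not> (\<exists>v u w L. T_shape v u w L \<and> card L = k - 3 \<and> T_edges v u w L \<subseteq> E)"

definition proper_col :: "('a set \<Rightarrow> nat) \<Rightarrow> 'a set set \<Rightarrow> bool" where
  "proper_col c E \<longleftrightarrow> (\<forall>e\<in>E. \<forall>e'\<in>E. e \<noteq> e' \<and> e \<inter> e' \<noteq> {} \<longrightarrow> c e \<noteq> c e')"

definition rainbow_free :: "nat \<Rightarrow> ('a set \<Rightarrow> nat) \<Rightarrow> 'a set set \<Rightarrow> bool" where
  "rainbow_free k c E \<longleftrightarrow> \<not> (\<exists>v u w L. T_shape v u w L \<and> card L = k - 3 \<and>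
     T_edges v u w L \<subseteq> E \<and> inj_on c (T_edges v u w L))"

definition avoids_rainbow_T :: "nat \<Rightarrow> 'a set set \<Rightarrow> bool" where
  "avoids_rainbow_T k E \<longleftrightarrow> (\<exists>c. proper_col c E \<and> rainbow_free k c E)"

lemma rainbow_freeI:
  assumes "\<And>v u w L. T_shape v u w L \<Longrightarrow> card L = k - 3 \<Longrightarrow> T_edges v u w L \<subseteq> E \<Longrightarrow>
    inj_on c (T_edges v u w L) \<Longrightarrow> False"
  shows "rainbow_free k c E"
  using assms unfolding rainbow_free_def by blast

lemma rainbow_freeD:
  "rainbow_free k c E \<Longrightarrow> T_shape v u w L \<Longrightarrow> card L = k - 3 \<Longrightarrow> T_edges v u w L \<subseteq> E \<Longrightarrow>
    inj_on c (T_edges v u w L) \<Longrightarrow> False"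
  unfolding rainbow_free_def by blast

lemma avoids_TD:
  "avoids_T k E \<Longrightarrow> T_shape v u w L \<Longrightarrow> card L = k - 3 \<Longrightarrow> T_edges v u w L \<subseteq> E \<Longrightarrow> False"
  unfolding avoids_T_def by blast

text \<open>Surplus leaves of a copy can be discarded.\<close>

lemma avoids_TD_large:
  assumes "avoids_T k E" "T_shape v u w L" "card L \<ge> k - 3" "T_edges v u w L \<subseteq> E"
  shows False
proof -
  obtain L' where "L' \<subseteq> L" "card L' = k - 3" using assms(3) by (meson obtain_subset_with_card_n)
  moreover from this have "T_shape v u w L'" "T_edges v u w L' \<subseteq> E"
    using assms(2,4) by (auto simp: T_shape_def T_edges_def intro: finite_subset)
  ultimately show False using avoids_TD[OF assms(1)] by blast
qed

section \<open>Saturation in terms of edge sets\<close>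

lemma simple_graph_add_edge: "simple_graph G \<Longrightarrow> e \<in> non_edges G \<Longrightarrow> simple_graph (add_edge G e)"
  by (auto simp: simple_graph_def non_edges_def add_edge_def)

lemma saturated_iff:
  assumes "simple_graph G" "k \<ge> 4"
  shows "saturated (T_star k) G \<longleftrightarrow>
    avoids_T k (edges G) \<and> (\<forall>e\<in>non_edges G. \<not> avoids_T k (insert e (edges G)))"
proof -
  have *: "contains_copy (T_star k) H \<longleftrightarrow> \<not> avoids_T k (edges H)" if "simple_graph H" for H :: "'a sgraph"
    using T_star_copy_iff[OF that assms(2), of "\<lambda>_. True"]
    unfolding contains_copy_def avoids_T_def by (simp only: not_not simp_thms)
  have "edges (add_edge G e) = insert e (edges G)" for e by (simp add: add_edge_def)
  then show ?thesis
    using * assms(1) simple_graph_add_edge[OF assms(1)] by (auto simp: saturated_def)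
qed

lemma properly_rainbow_saturated_iff:
  assumes "simple_graph G" "k \<ge> 4"
  shows "properly_rainbow_saturated (T_star k) G \<longleftrightarrow> avoids_rainbow_T k (edges G) \<and>
    (\<forall>e\<in>non_edges G. \<not> avoids_rainbow_T k (insert e (edges G)))"
proof -
  have *: "contains_rainbow_copy c (T_star k) H \<longleftrightarrow> \<not> rainbow_free k c (edges H)"
    if "simple_graph H" for H :: "'a sgraph" and c :: "'a set \<Rightarrow> nat"
    using T_star_copy_iff[OF that assms(2), of "inj_on c"]
    unfolding contains_rainbow_copy_def rainbow_free_def by (simp only: not_not simp_thms)
  have p: "proper_edge_colouring c H \<longleftrightarrow> proper_col c (edges H)" for c and H :: "'a sgraph"
    by (simp add: proper_edge_colouring_def proper_col_def)
  have "edges (add_edge G e) = insert e (edges G)" for e by (simp add: add_edge_def)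
  then show ?thesis
    using * p assms(1) simple_graph_add_edge[OF assms(1)]
    by (auto simp: properly_rainbow_saturated_def avoids_rainbow_T_def)
qed

lemma avoids_rainbow_TD:
  assumes "k \<ge> 4" "avoids_rainbow_T k E"
  shows "avoids_T (k + 1) E"
  unfolding avoids_T_def
proof (intro notI, elim exE conjE)
  fix v u w L
  assume T: "T_shape v u w L" "card L = k + 1 - 3" "T_edges v u w L \<subseteq> E"
  obtain c where c: "proper_col c E" "rainbow_free k c E"
    using assms(2) by (auto simp: avoids_rainbow_T_def)
  have E: "{v, u} \<in> E" "{u, w} \<in> E" "\<And>x. x \<in> L \<Longrightarrow> {v, x} \<in> E"
    using T(3) by (auto simp: T_edges_subset_iff)
  have neq: "c {v, x} \<noteq> c {v, y}" if "x \<in> insert u L" "y \<in> insert u L" "x \<noteq> y" for x y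
    using c(1) E that unfolding proper_col_def by (metis disjoint_insert(1) doubleton_eq_iff insertE insertI1)
  have uneq: "c {v, u} \<noteq> c {u, w}"
    using c(1) E T(1) unfolding proper_col_def T_shape_def
    by (metis disjoint_iff doubleton_eq_iff insertCI)
  have fin: "finite L" using T(1) by (simp add: T_shape_def)
  \<comment> \<open>properness allows at most one edge at the centre to repeat the colour of the pendant edge\<close>
  have "\<exists>L'\<subseteq>L. card L' = k - 3 \<and> (\<forall>x\<in>L'. c {v, x} \<noteq> c {u, w})"
  proof (cases "\<exists>z\<in>L. c {v, z} = c {u, w}")
    case True
    then obtain z where z: "z \<in> L" "c {v, z} = c {u, w}" by blast
    then show ?thesis
      using neq T(2) fin assms(1) by (intro exI[of _ "L - {z}"]) (auto, metis insertI2)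
  next
    case False
    then show ?thesis using T(2) obtain_subset_with_card_n[of "k - 3" L] assms(1)
      by (metis diff_le_mono le_add1 subsetD)
  qed
  then obtain L' where L': "L' \<subseteq> L" "card L' = k - 3" "\<forall>x\<in>L'. c {v, x} \<noteq> c {u, w}" by blast
  have "T_shape v u w L'" "T_edges v u w L' \<subseteq> E"
    using T(1,3) L'(1) by (auto simp: T_shape_def T_edges_def intro: finite_subset)
  moreover have "inj_on c (T_edges v u w L')"
  proof -
    have "inj_on c ((\<lambda>x. {v, x}) ` L')"
      using neq L'(1) by (intro inj_onI, elim imageE) (metis insertI2 subsetD)
    moreover have "c {v, u} \<noteq> c {v, x}" if "x \<in> L'" for x
      using neq[of u x] that L'(1) T(1) by (auto simp: T_shape_def)
    ultimately show ?thesis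
      using uneq L'(3) unfolding T_edges_def inj_on_insert by fastforce
  qed
  ultimately show False using rainbow_freeD[OF c(2)] L'(2) by blast
qed

section \<open>Disjoint unions and subsets\<close>

text \<open>The tree is connected: its other edges meet \<open>{v, u}\<close> in \<open>u\<close> or
  in \<open>v\<close>, and edges with a common vertex lie on the same side.\<close>

lemma T_edges_in_disjoint_union:
  assumes "T_edges v u w L \<subseteq> E \<union> F" "\<Union>E \<inter> \<Union>F = {}"
  shows "T_edges v u w L \<subseteq> E \<or> T_edges v u w L \<subseteq> F"
proof -
  have *: "e \<in> E \<longleftrightarrow> e' \<in> E" if "e \<in> E \<union> F" "e' \<in> E \<union> F" "x \<in> e" "x \<in> e'" for e e' x
    using that assms(2) by blast
  have m: "{v, u} \<in> E \<union> F" "{u, w} \<in> E \<union> F" "\<And>x. x \<in> L \<Longrightarrow> {v, x} \<in> E \<union> F"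
    using assms(1) by (auto simp: T_edges_subset_iff)
  show ?thesis
  proof (cases "{v, u} \<in> E")
    case True
    then have "{u, w} \<in> E" "\<And>x. x \<in> L \<Longrightarrow> {v, x} \<in> E"
      using *[OF m(1,2), of u] *[OF m(1) m(3), of _ v] by auto
    then show ?thesis using True by (simp add: T_edges_subset_iff)
  next
    case False
    then have "{u, w} \<notin> E" "\<And>x. x \<in> L \<Longrightarrow> {v, x} \<notin> E"
      using *[OF m(1,2), of u] *[OF m(1) m(3), of _ v] by auto
    then show ?thesis using False m by (auto simp: T_edges_subset_iff)
  qed
qed

lemma avoids_T_union:
  "avoids_T k E \<Longrightarrow> avoids_T k F \<Longrightarrow> \<Union>E \<inter> \<Union>F = {} \<Longrightarrow> avoids_T k (E \<union> F)"
  using T_edges_in_disjoint_union unfolding avoids_T_def by metis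

text \<open>The two colourings may be glued even if they share colours, since edges from different
  sides never meet and a copy lies within one side.\<close>

lemma avoids_rainbow_T_union:
  assumes "avoids_rainbow_T k E" "avoids_rainbow_T k F" and disj: "\<Union>E \<inter> \<Union>F = {}"
  shows "avoids_rainbow_T k (E \<union> F)"
proof -
  obtain c d where c: "proper_col c E" "rainbow_free k c E" and d: "proper_col d F" "rainbow_free k d F"
    using assms by (auto simp: avoids_rainbow_T_def)
  define b where "b e = (if e \<in> E then c e else d e)" for e
  \<comment> \<open>Nonemptiness matters: the empty set could belong to both \<open>E\<close> and
    \<open>F\<close> although their unions are disjoint.\<close>
  have bF: "b e = d e" if "e \<in> F" "e \<noteq> {}" for e using that disj by (auto simp: b_def)
  have cross: "e \<inter> e' = {}" if "e \<in> E" "e' \<in> F" for e e' using that disj by blast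
  have "proper_col b (E \<union> F)"
    unfolding proper_col_def
  proof (intro ballI impI)
    fix e e' assume e: "e \<in> E \<union> F" "e' \<in> E \<union> F" "e \<noteq> e' \<and> e \<inter> e' \<noteq> {}"
    then consider "e \<in> E" "e' \<in> E" | "e \<in> F" "e' \<in> F"
      using cross by (metis UnE inf_commute)
    then show "b e \<noteq> b e'"
    proof cases
      case 1 then show ?thesis using c(1) e(3) by (simp add: b_def proper_col_def)
    next
      case 2 then show ?thesis using d(1) e(3) bF[of e] bF[of e'] unfolding proper_col_def by (metis inf_bot_left inf_bot_right)
    qed
  qed
  moreover have "rainbow_free k b (E \<union> F)"
  proof (rule rainbow_freeI)
    fix v u w L
    assume T: "T_shape v u w L" "card L = k - 3" "T_edges v u w L \<subseteq> E \<union> F" "inj_on b (T_edges v u w L)"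
    from T_edges_in_disjoint_union[OF T(3) disj] show False
    proof
      assume a: "T_edges v u w L \<subseteq> E"
      have "inj_on c (T_edges v u w L) = inj_on b (T_edges v u w L)"
        using a by (intro inj_on_cong) (auto simp: b_def)
      then show False using T(4) rainbow_freeD[OF c(2) T(1,2) a] by simp
    next
      assume a: "T_edges v u w L \<subseteq> F"
      have "{} \<notin> T_edges v u w L" by (auto simp: T_edges_def)
      then have "inj_on d (T_edges v u w L) = inj_on b (T_edges v u w L)"
        using a bF by (intro inj_on_cong) (metis subsetD)
      then show False using T(4) rainbow_freeD[OF d(2) T(1,2) a] by simp
    qed
  qed
  ultimately show ?thesis by (auto simp: avoids_rainbow_T_def)
qed

lemma avoids_T_mono: "avoids_T k E \<Longrightarrow> F \<subseteq> E \<Longrightarrow> avoids_T k F"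
  unfolding avoids_T_def by blast

lemma avoids_rainbow_T_mono:
  assumes "avoids_rainbow_T k E" "F \<subseteq> E"
  shows "avoids_rainbow_T k F"
proof -
  obtain c where c: "proper_col c E" "rainbow_free k c E"
    using assms(1) by (auto simp: avoids_rainbow_T_def)
  have "proper_col c F" using c(1) assms(2) unfolding proper_col_def by blast
  moreover have "rainbow_free k c F"
    using rainbow_freeD[OF c(2)] assms(2) by (meson rainbow_freeI subset_trans)
  ultimately show ?thesis by (auto simp: avoids_rainbow_T_def)
qed

section \<open>Joining an isolated vertex to a leaf\<close>

text \<open>A copy of the tree that uses the new edge at an isolated vertex \<open>x\<close> uses it either as
  its pendant edge or, if the centre has degree two, as the unsubdivided edge at the centre.\<close>

lemma T_edges_new_leaf:
  assumes E: "edge_set E" and x: "x \<notin> \<Union>E" "x \<noteq> y" and y: "neighbours E y = {z}"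
    and T: "T_shape v u w L" "L \<noteq> {}" "T_edges v u w L \<subseteq> insert {x, y} E"
    and new: "{x, y} \<in> T_edges v u w L"
  shows "(v = z \<and> u = y \<and> w = x \<and> L \<subseteq> neighbours E z - {y}) \<or>
    (v = y \<and> u = z \<and> L = {x} \<and> w \<in> neighbours E z - {y})"
proof -
  have m: "{v, u} \<in> insert {x, y} E" "{u, w} \<in> insert {x, y} E" "\<And>a. a \<in> L \<Longrightarrow> {v, a} \<in> insert {x, y} E"
    using T(3) by (auto simp: T_edges_subset_iff)
  have nx: "a = y" if "{x, a} \<in> insert {x, y} E" for a
  proof -
    have "{x, a} \<notin> E" using x(1) by blast
    then show ?thesis using that x(2) by (auto simp: doubleton_eq_iff)
  qed
  have ny: "a = x \<or> a = z" if "{y, a} \<in> insert {x, y} E" for a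
  proof (cases "{y, a} \<in> E")
    case True
    then have "a \<in> neighbours E y" by (simp add: in_neighbours)
    then show ?thesis using y by simp
  next
    case False
    then have "{y, a} = {x, y}" using that by simp
    then show ?thesis using x(2) by (auto simp: doubleton_eq_iff)
  qed
  have sh: "v \<noteq> u" "v \<noteq> w" "u \<noteq> w" "v \<notin> L" "u \<notin> L" "w \<notin> L" using T(1) by (auto simp: T_shape_def)
  obtain l where l: "l \<in> L" using T(2) by blast
  have vx: "v \<noteq> x"
  proof
    assume "v = x"
    then have "u = y" "l = y" using m(1) m(3)[OF l] nx by auto
    then show False using sh l by blast
  qed
  have ux: "u \<noteq> x"
  proof
    assume "u = x"
    then have "v = y" "w = y" using m(1,2) nx[of v] nx[of w] by (simp_all add: insert_commute[of v x])
    then show False using sh by blast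
  qed
  have "{x, y} = {v, u} \<or> {x, y} = {u, w} \<or> (\<exists>a\<in>L. {x, y} = {v, a})"
    using new unfolding T_edges_def by blast
  then have "u = y \<and> w = x \<or> v = y \<and> x \<in> L"
    using vx ux unfolding doubleton_eq_iff by blast
  then consider "u = y" "w = x" | "v = y" "x \<in> L" by blast
  then show ?thesis
  proof cases
    case 1
    have "v = z" using ny[of v] m(1) 1 vx by (simp add: insert_commute[of v])
    moreover have "L \<subseteq> neighbours E z - {y}"
    proof
      fix a assume a: "a \<in> L"
      then have "{z, a} \<in> insert {x, y} E" "a \<noteq> y" "a \<noteq> x" using m(3) 1 sh \<open>v = z\<close> by blast+
      moreover from this have "{z, a} \<noteq> {x, y}" using vx \<open>v = z\<close> by blast
      ultimately show "a \<in> neighbours E z - {y}" by (simp add: in_neighbours)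
    qed
    ultimately show ?thesis using 1 by blast
  next
    case 2
    have u: "u = z" using ny[of u] m(1) 2 ux by simp
    moreover have "L = {x}"
    proof -
      have "a = x" if "a \<in> L" for a using ny[of a] m(3)[OF that] 2 that u sh by blast
      then show ?thesis using 2 by blast
    qed
    moreover have "w \<in> neighbours E z - {y}"
    proof -
      have "w \<noteq> x" "w \<noteq> y" using 2 sh by blast+
      then have "{u, w} \<noteq> {x, y}" using ux by blast
      then show ?thesis using m(2) u \<open>w \<noteq> y\<close> by (simp add: in_neighbours)
    qed
    ultimately show ?thesis using 2 by blast
  qed
qed

text \<open>Here \<open>L\<close> has \<open>k - 2 \<ge> 2\<close> elements, so only the first form
  in \<open>T_edges_new_leaf\<close> remains. It requires \<open>k - 2\<close> neighbours of
  \<open>z\<close> besides \<open>y\<close>, but there are at most \<open>k - 3\<close>.\<close>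

lemma avoids_T_new_leaf:
  assumes k: "k \<ge> 4" and E: "edge_set E" "avoids_T (k + 1) E" and x: "x \<notin> \<Union>E" "x \<noteq> y"
    and y: "neighbours E y = {z}" and z: "card (neighbours E z) \<le> k - 2"
  shows "avoids_T (k + 1) (insert {x, y} E)"
  unfolding avoids_T_def
proof (intro notI, elim exE conjE)
  fix v u w L
  assume T: "T_shape v u w L" "card L = k + 1 - 3" "T_edges v u w L \<subseteq> insert {x, y} E"
  have fin: "finite L" using T(1) by (simp add: T_shape_def)
  have ne: "L \<noteq> {}" using T(2) k by auto
  have new: "{x, y} \<in> T_edges v u w L" using avoids_TD[OF E(2) T(1,2)] T(3) by blast
  have "card L \<noteq> 1" using T(2) k by simp
  then have L: "L \<subseteq> neighbours E z - {y}"
    using T_edges_new_leaf[OF E(1) x y T(1) ne T(3) new] by auto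
  have "y \<in> neighbours E z" using y neighbours_sym by fastforce
  then have "card (neighbours E z - {y}) < card (neighbours E z)"
    by (intro card_Diff1_less finite_neighbours E)
  moreover have "card L \<le> card (neighbours E z - {y})"
    using L E(1) by (intro card_mono) (auto intro: finite_neighbours)
  ultimately show False using T(2) z by linarith
qed

text \<open>By the degree bound, a copy through the new edge must use every edge from
  \<open>z\<close> to a vertex other than \<open>y\<close>, and there is at least one. Repeating the
  colour of such an edge on the new edge therefore spoils the copy.\<close>

lemma avoids_rainbow_T_new_leaf:
  assumes k: "k \<ge> 4" and E: "edge_set E" "avoids_rainbow_T k E" and x: "x \<notin> \<Union>E" "x \<noteq> y"
    and y: "neighbours E y = {z}" and z: "card (neighbours E z) \<le> k - 2"
  shows "avoids_rainbow_T k (insert {x, y} E)"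
proof -
  obtain c where c: "proper_col c E" "rainbow_free k c E"
    using E(2) by (auto simp: avoids_rainbow_T_def)
  have new: "{x, y} \<notin> E" using x by blast
  have yz: "{y, z} \<in> E" using y by (auto simp: neighbours_def)
  have zy: "y \<in> neighbours E z" using yz by (simp add: neighbours_def insert_commute)
  define N where "N = neighbours E z - {y}"
  have finN: "finite N" using E(1) by (simp add: N_def finite_neighbours)
  have cardN: "card N \<le> k - 3" using z zy by (simp add: N_def)
  \<comment> \<open>colour the new edge like some other edge at \<open>z\<close>, if there is one\<close>
  obtain col where col: "col \<noteq> c {y, z}" "N \<noteq> {} \<Longrightarrow> \<exists>a\<in>N. col = c {z, a}"
  proof (cases "N = {}")
    case True
    \<comment> \<open>Any colour other than that of \<open>{y, z}\<close> will do: no copy can use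
      the new edge if \<open>N\<close> is empty.\<close>
    then show ?thesis using that[of "Suc (c {y, z})"] by simp
  next
    case False
    then obtain a where a: "a \<in> N" by blast
    then have a': "{z, a} \<in> E" "a \<noteq> y" by (auto simp: N_def neighbours_def)
    then have "c {z, a} \<noteq> c {y, z}"
      using c(1) yz unfolding proper_col_def by (metis disjoint_iff doubleton_eq_iff insertCI)
    then show ?thesis using that a by blast
  qed
  define d where "d = c({x, y} := col)"
  have dc: "d e = c e" if "e \<in> E" for e using that new by (auto simp: d_def)
  have dnew: "d {x, y} = col" by (simp add: d_def)
  \<comment> \<open>As \<open>y\<close> was a leaf, \<open>{y, z}\<close> is the only old edge with
    which the new colour can conflict.\<close>
  have touch: "e = {y, z}" if e: "e \<in> E" "e \<inter> {x, y} \<noteq> {}" for e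
  proof -
    have "y \<in> e" using e x by blast
    then obtain b where "e = {y, b}" "b \<in> neighbours E y" using edge_set_at[OF E(1) e(1)] by blast
    then show ?thesis using y by simp
  qed
  have "proper_col d (insert {x, y} E)"
    unfolding proper_col_def
  proof (intro ballI impI)
    fix e e' assume e: "e \<in> insert {x, y} E" "e' \<in> insert {x, y} E" "e \<noteq> e' \<and> e \<inter> e' \<noteq> {}"
    then consider "e \<in> E" "e' \<in> E" | "e = {x, y}" "e' \<in> E" | "e' = {x, y}" "e \<in> E" by blast
    then show "d e \<noteq> d e'"
    proof cases
      case 1 then show ?thesis using c(1) e(3) dc unfolding proper_col_def by metis
    next
      case 2
      then have "e' = {y, z}" using touch[of e'] e(3) by (simp add: inf_commute)
      then show ?thesis using 2 col(1) dnew dc[OF yz] by simp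
    next
      case 3
      then have "e = {y, z}" using touch[of e] e(3) by simp
      then show ?thesis using 3 col(1) dnew dc[OF yz] by simp
    qed
  qed
  moreover have "rainbow_free k d (insert {x, y} E)"
  proof (rule rainbow_freeI)
    fix v u w L
    assume T: "T_shape v u w L" "card L = k - 3" "T_edges v u w L \<subseteq> insert {x, y} E"
      "inj_on d (T_edges v u w L)"
    have fin: "finite L" using T(1) by (simp add: T_shape_def)
    have ne: "L \<noteq> {}" using T(2) k by auto
    have used: "{x, y} \<in> T_edges v u w L"
    proof (rule ccontr)
      assume "{x, y} \<notin> T_edges v u w L"
      then have s: "T_edges v u w L \<subseteq> E" using T(3) by blast
      have "inj_on c (T_edges v u w L) = inj_on d (T_edges v u w L)"
        using s dc by (intro inj_on_cong) (metis subsetD)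
      then show False using rainbow_freeD[OF c(2) T(1,2) s] T(4) by simp
    qed
    have "(\<forall>a\<in>N. {z, a} \<in> T_edges v u w L) \<and> N \<noteq> {}"
      using T_edges_new_leaf[OF E(1) x y T(1) ne T(3) used, folded N_def]
    proof (elim disjE conjE)
      assume a: "v = z" "L \<subseteq> N"
      then have "L = N" using cardN finN T(2) by (metis card_seteq)
      then show ?thesis using a ne by (auto simp: T_edges_def)
    next
      \<comment> \<open>A single leaf means \<open>k = 4\<close>, so \<open>N\<close> has at most
        one element.\<close>
      assume a: "u = z" "L = {x}" "w \<in> N"
      then have "card N \<le> 1" using cardN T(2) by simp
      then have "N = {w}" using a finN by (auto simp: card_le_Suc0_iff_eq)
      then show ?thesis using a by (auto simp: T_edges_def)
    qed
    then obtain a where a: "a \<in> N" "col = c {z, a}" "{z, a} \<in> T_edges v u w L" using col(2) by blast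
    have "{z, a} \<in> E" using a(1) by (simp add: N_def neighbours_def)
    then have "d {z, a} = d {x, y}" "{z, a} \<noteq> {x, y}" using a dc dnew new by auto
    then show False using T(4) a(3) used by (meson inj_onD)
  qed
  ultimately show ?thesis by (auto simp: avoids_rainbow_T_def)
qed

section \<open>Colourings without a rainbow copy\<close>

lemma Union_T_edges: "\<Union>(T_edges v u w L) = {v, u, w} \<union> L"
  by (auto simp: T_edges_def)

lemma card_Union_T_edges:
  assumes "k \<ge> 4" "T_shape v u w L" "card L = k - 3"
  shows "card (\<Union>(T_edges v u w L)) = k"
proof -
  have "card ({v, u, w} \<union> L) = card {v, u, w} + card L"
    using assms(2) by (intro card_Un_disjoint) (auto simp: T_shape_def)
  then show ?thesis using assms by (simp add: Union_T_edges T_shape_def)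
qed

text \<open>The tree contains a path with three edges, and these have no common vertex.\<close>

lemma T_edges_not_star:
  assumes "T_shape v u w L" "L \<noteq> {}"
  shows "\<exists>e\<in>T_edges v u w L. b \<notin> e"
proof -
  obtain l where l: "l \<in> L" using assms(2) by blast
  then have "v \<noteq> u" "v \<noteq> w" "u \<noteq> w" "l \<noteq> v" "l \<noteq> u"
    using assms(1) by (auto simp: T_shape_def)
  then have "b \<notin> {v, u} \<or> b \<notin> {u, w} \<or> b \<notin> {v, l}" by simp metis
  moreover have "{v, u} \<in> T_edges v u w L" "{u, w} \<in> T_edges v u w L" "{v, l} \<in> T_edges v u w L"
    using l by (auto simp: T_edges_def)
  ultimately show ?thesis by metis
qed

lemma exists_inj_col: "edge_set E \<Longrightarrow> \<exists>h :: 'a set \<Rightarrow> nat. inj_on h E"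
  by (metis finite_imp_inj_to_nat_seg edge_setD(1))

lemma inj_col_proper: "inj_on c E \<Longrightarrow> proper_col c E"
  unfolding proper_col_def by (metis inj_onD)

lemma avoids_rainbow_T_if_no_T:
  assumes "edge_set E" "avoids_T k E"
  shows "avoids_rainbow_T k E"
proof -
  obtain h :: "'a set \<Rightarrow> nat" where "inj_on h E" using exists_inj_col assms(1) by blast
  then show ?thesis
    using assms(2) inj_col_proper unfolding avoids_rainbow_T_def rainbow_free_def avoids_T_def by blast
qed

lemma avoids_rainbow_T_star:
  assumes "k \<ge> 4" "edge_set E" "\<And>e. e \<in> E \<Longrightarrow> b \<in> e"
  shows "avoids_rainbow_T k E"
proof (rule avoids_rainbow_T_if_no_T[OF assms(2)], unfold avoids_T_def, intro notI, elim exE conjE)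
  fix v u w L assume T: "T_shape v u w L" "card L = k - 3" "T_edges v u w L \<subseteq> E"
  have "L \<noteq> {}" using T(2) assms(1) by auto
  then show False using T_edges_not_star[OF T(1), of b] T(3) assms(3) by blast
qed

lemma avoids_rainbow_T_few_vertices:
  assumes "k \<ge> 4" "edge_set E" "card (\<Union>E) < k"
  shows "avoids_rainbow_T k E"
proof (rule avoids_rainbow_T_if_no_T[OF assms(2)], unfold avoids_T_def, intro notI, elim exE conjE)
  fix v u w L assume T: "T_shape v u w L" "card L = k - 3" "T_edges v u w L \<subseteq> E"
  have "card (\<Union>(T_edges v u w L)) \<le> card (\<Union>E)"
    using T(3) assms(2) by (intro card_mono finite_Union_edge_set Union_mono)
  then show False using card_Union_T_edges[OF assms(1) T(1,2)] assms(3) by simp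
qed

text \<open>A rainbow copy shows \<open>k - 1\<close> colours, one on each edge.\<close>

lemma avoids_rainbow_T_few_colours:
  assumes "k \<ge> 4" "finite E" "proper_col c E" "card (c ` E) < k - 1"
  shows "avoids_rainbow_T k E"
proof -
  have "rainbow_free k c E"
  proof (rule rainbow_freeI)
    fix v u w L assume T: "T_shape v u w L" "card L = k - 3" "T_edges v u w L \<subseteq> E" "inj_on c (T_edges v u w L)"
    have "card (c ` T_edges v u w L) = k - 1"
      using card_image[OF T(4)] card_T_edges[OF T(1)] T(2) assms(1) by simp
    moreover have "card (c ` T_edges v u w L) \<le> card (c ` E)"
      using T(3) assms(2) by (intro card_mono) auto
    ultimately show False using assms(4) by simp
  qed
  then show ?thesis using assms(3) by (auto simp: avoids_rainbow_T_def)
qed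

section \<open>Adding an edge to a small tree\<close>

text \<open>Closing a path on four vertices to a 4-cycle and colouring that cycle with two colours
  saves two edges for any rainbow subgraph.\<close>

lemma avoids_rainbow_T_close_path:
  assumes k: "k \<ge> 4" and E: "edge_set E" "card E \<le> k - 1"
    and path: "neighbours E a = {b}" "{b, c} \<in> E" "{c, d} \<in> E" "c \<noteq> a" "d \<noteq> b"
  shows "avoids_rainbow_T k (insert {a, d} E)"
proof -
  have ab: "{a, b} \<in> E" using path(1) by (auto simp: neighbours_def)
  have da: "d \<noteq> a"
  proof
    assume "d = a"
    then have "c \<in> neighbours E a" using path(3) by (simp add: in_neighbours insert_commute)
    then show False using path edge_set_neq[OF E(1) path(2)] by simp
  qed
  have ad: "{a, d} \<notin> E" using path(1,5) by (auto simp: neighbours_def)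
  have ne: "a \<noteq> b" "b \<noteq> c" "c \<noteq> d" using ab path E(1) edge_set_neq by metis+
  obtain h :: "'a set \<Rightarrow> nat" where h: "inj_on h E" using exists_inj_col E(1) by blast
  \<comment> \<open>\<open>p\<close> identifies opposite edges of the cycle \<open>a\<close>,
    \<open>b\<close>, \<open>c\<close>, \<open>d\<close>; all other edges keep colours of their
    own.\<close>
  define p where "p e = (if e = {c, d} then {a, b} else if e = {a, d} then {b, c} else e)" for e
  have cd: "{c, d} \<noteq> {a, b}" "{c, d} \<noteq> {b, c}" "{c, d} \<noteq> {a, d}"
    using ne path da by (auto simp: doubleton_eq_iff)
  \<comment> \<open>The colour of \<open>{c, d}\<close> is freed and none is added, so at most
    \<open>card E - 1 \<le> k - 2\<close> colours occur.\<close>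
  have p: "p ` insert {a, d} E \<subseteq> E - {{c, d}}"
    using ab path(2) cd by (auto simp: p_def)
  have "proper_col (h \<circ> p) (insert {a, d} E)"
    unfolding proper_col_def
  proof (intro ballI impI notI)
    fix e e' assume e: "e \<in> insert {a, d} E" "e' \<in> insert {a, d} E" "e \<noteq> e' \<and> e \<inter> e' \<noteq> {}"
      and "(h \<circ> p) e = (h \<circ> p) e'"
    then have "h (p e) = h (p e')" "p e \<in> E" "p e' \<in> E" using p by auto
    then have "p e = p e'" using h by (meson inj_onD)
    \<comment> \<open>Only opposite edges of the cycle share a colour, and these are
      disjoint.\<close>
    then have "{e, e'} = {{c, d}, {a, b}} \<or> {e, e'} = {{a, d}, {b, c}} \<or> {a, b} = {b, c}"
      using e(3) unfolding p_def by (auto split: if_splits)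
    moreover have "{c, d} \<inter> {a, b} = {}" "{a, d} \<inter> {b, c} = {}" "{a, b} \<noteq> {b, c}"
      using ne path(4,5) da by (auto simp: doubleton_eq_iff)
    ultimately show False using e(3) unfolding doubleton_eq_iff by (metis inf_commute)
  qed
  moreover have "card ((h \<circ> p) ` insert {a, d} E) < k - 1"
  proof -
    have f: "finite E" using E(1) edge_setD by blast
    have "card ((h \<circ> p) ` insert {a, d} E) \<le> card (h ` (E - {{c, d}}))"
      using p f by (intro card_mono) auto
    also have "\<dots> \<le> card (E - {{c, d}})" using f by (intro card_image_le) simp
    also have "\<dots> < card E" using f path(3) by (intro card_Diff1_less)
    finally show ?thesis using E(2) by simp
  qed
  moreover have "finite (insert {a, d} E)" using E(1) edge_setD by auto
  ultimately show ?thesis using avoids_rainbow_T_few_colours[OF k] by blast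
qed

text \<open>The new edge receives the colour of \<open>{b, x}\<close>. With at most \<open>k\<close>
  vertices available, a copy covers all of them and so contains \<open>{b, x}\<close>, the only edge
  at \<open>x\<close>. If it is rainbow, it then avoids the new edge and lies in a star, which is
  impossible.\<close>

lemma avoids_rainbow_T_close_star:
  assumes k: "k \<ge> 4" and E: "edge_set E" "card (\<Union>E) \<le> k" and star: "\<And>e. e \<in> E \<Longrightarrow> b \<in> e"
    and xyz: "{b, x} \<in> E" "{b, y} \<in> E" "{b, z} \<in> E" "x \<noteq> y" "x \<noteq> z" "y \<noteq> z"
  shows "avoids_rainbow_T k (insert {y, z} E)"
proof -
  obtain h :: "'a set \<Rightarrow> nat" where h: "inj_on h E" using exists_inj_col E(1) by blast
  have ne: "b \<noteq> x" "b \<noteq> y" "b \<noteq> z" using xyz E(1) edge_set_neq by metis+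
  have new: "{y, z} \<notin> E" using star ne by blast
  define c where "c = h({y, z} := h {b, x})"
  have cE: "c e = h e" if "e \<in> E" for e using that new by (auto simp: c_def)
  have cnew: "c {y, z} = h {b, x}" by (simp add: c_def)
  have eq: "e = {b, x}" if "e \<in> E" "c e = c {y, z}" for e
    using that cE cnew h xyz(1) by (metis inj_onD)
  have disj: "{y, z} \<inter> {b, x} = {}" using ne xyz by auto
  have "proper_col c (insert {y, z} E)"
    unfolding proper_col_def
  proof (intro ballI impI)
    fix e e' assume e: "e \<in> insert {y, z} E" "e' \<in> insert {y, z} E" "e \<noteq> e' \<and> e \<inter> e' \<noteq> {}"
    then consider "e \<in> E" "e' \<in> E" | "e = {y, z}" "e' \<in> E" | "e' = {y, z}" "e \<in> E" by blast
    then show "c e \<noteq> c e'"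
    proof cases
      case 1 then show ?thesis using cE h e(3) by (metis inj_onD)
    next
      case 2 then show ?thesis using eq[of e'] e(3) disj by force
    next
      case 3 then show ?thesis using eq[of e] e(3) disj by force
    qed
  qed
  moreover have "rainbow_free k c (insert {y, z} E)"
  proof (rule rainbow_freeI)
    fix v u w L assume T: "T_shape v u w L" "card L = k - 3" "T_edges v u w L \<subseteq> insert {y, z} E"
      "inj_on c (T_edges v u w L)"
    have "\<Union>(T_edges v u w L) \<subseteq> \<Union>E" using T(3) xyz by blast
    then have "\<Union>(T_edges v u w L) = \<Union>E"
      using card_Union_T_edges[OF k T(1,2)] E finite_Union_edge_set by (metis card_seteq)
    then have "x \<in> \<Union>(T_edges v u w L)" using xyz(1) by auto
    then obtain e where e: "e \<in> T_edges v u w L" "x \<in> e" by blast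
    then have eE: "e \<in> E" using T(3) xyz by auto
    obtain q where "e = {x, q}" using edge_set_at[OF E(1) eE e(2)] .
    moreover have "b \<in> e" using star eE .
    ultimately have "e = {b, x}" using ne(1) by blast
    then have "c e = c {y, z}" "e \<noteq> {y, z}" using cE eE cnew new by auto
    then have "{y, z} \<notin> T_edges v u w L" using e(1) T(4) by (meson inj_onD)
    then have "T_edges v u w L \<subseteq> E" using T(3) by blast
    moreover have "L \<noteq> {}" using T(2) k by auto
    ultimately show False using T_edges_not_star[OF T(1), of b] star by blast
  qed
  ultimately show ?thesis by (auto simp: avoids_rainbow_T_def)
qed

section \<open>Components\<close>

definition component :: "'a set set \<Rightarrow> 'a \<Rightarrow> 'a set" where
  "component E v = {u. (v, u) \<in> {(a, b). {a, b} \<in> E}\<^sup>*}"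

definition closed_under :: "'a set set \<Rightarrow> 'a set \<Rightarrow> bool" where
  "closed_under E C \<longleftrightarrow> (\<forall>a\<in>C. neighbours E a \<subseteq> C)"

definition inner_edges :: "'a set set \<Rightarrow> 'a set \<Rightarrow> 'a set set" where
  "inner_edges E C = {e \<in> E. e \<subseteq> C}"

lemma component_self: "v \<in> component E v"
  by (simp add: component_def)

lemma closed_component: "closed_under E (component E v)"
  by (auto simp: closed_under_def component_def neighbours_def intro: rtrancl_into_rtrancl)

lemma component_least:
  assumes "closed_under E S" "v \<in> S"
  shows "component E v \<subseteq> S"
proof
  fix u assume "u \<in> component E v"
  then have "(v, u) \<in> {(a, b). {a, b} \<in> E}\<^sup>*" by (simp add: component_def)
  then show "u \<in> S"
    by induction (use assms in \<open>auto simp: closed_under_def neighbours_def\<close>)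
qed

lemma component_eq:
  assumes "u \<in> component E v"
  shows "component E u = component E v"
proof -
  have "sym ({(a, b). {a, b} \<in> E}\<^sup>*)" by (rule sym_rtrancl) (auto simp: sym_def insert_commute)
  then have "v \<in> component E u" using assms by (auto simp: component_def sym_def)
  then show ?thesis
    using assms component_least closed_component by (metis subset_antisym)
qed

lemma component_disjoint:
  assumes "component E u \<noteq> component E v"
  shows "component E u \<inter> component E v = {}"
proof (rule ccontr)
  assume "component E u \<inter> component E v \<noteq> {}"
  then obtain x where "x \<in> component E u" "x \<in> component E v" by blast
  then show False using component_eq[of x E u] component_eq[of x E v] assms by simp
qed

lemma inner_edges_insert:
  assumes "edge_set E" "b \<notin> S"
  shows "card (inner_edges E (insert b S)) = card (inner_edges E S) + card (neighbours E b \<inter> S)"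
proof -
  have "inner_edges E (insert b S) = inner_edges E S \<union> (\<lambda>x. {b, x}) ` (neighbours E b \<inter> S)"
  proof (rule set_eqI, rule iffI)
    fix e assume e: "e \<in> inner_edges E (insert b S)"
    then have eE: "e \<in> E" "e \<subseteq> insert b S" by (auto simp: inner_edges_def)
    show "e \<in> inner_edges E S \<union> (\<lambda>x. {b, x}) ` (neighbours E b \<inter> S)"
    proof (cases "b \<in> e")
      case True
      then obtain x where "e = {b, x}" "b \<noteq> x" "x \<in> neighbours E b" using edge_set_at[OF assms(1) eE(1)] by blast
      then show ?thesis using eE(2) by auto
    next
      case False
      then show ?thesis using eE by (auto simp: inner_edges_def)
    qed
  qed (auto simp: inner_edges_def neighbours_def)
  moreover have "inner_edges E S \<inter> (\<lambda>x. {b, x}) ` (neighbours E b \<inter> S) = {}"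
    using assms(2) by (auto simp: inner_edges_def)
  moreover have "inj_on (\<lambda>x. {b, x}) (neighbours E b \<inter> S)"
    by (auto simp: inj_on_def doubleton_eq_iff)
  moreover have "finite (inner_edges E S)" using edge_setD(1)[OF assms(1)] by (simp add: inner_edges_def)
  ultimately show ?thesis
    using finite_neighbours[OF assms(1)] by (simp add: card_Un_disjoint card_image)
qed

text \<open>Stands in for spanning trees: the component is grown vertex by vertex from
  \<open>v\<close>, and each new vertex brings at least one edge to the earlier ones.\<close>

lemma component_growth:
  assumes E: "edge_set E" and fin: "finite (component E v)"
  shows "Suc j \<le> card (component E v) \<Longrightarrow>
    \<exists>S \<subseteq> component E v. v \<in> S \<and> card S = Suc j \<and> j \<le> card (inner_edges E S)"
proof (induction j)
  case 0
  show ?case by (intro exI[of _ "{v}"]) (simp add: component_self)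
next
  case (Suc j)
  then obtain S where S: "S \<subseteq> component E v" "v \<in> S" "card S = Suc j" "j \<le> card (inner_edges E S)"
    by auto
  have finS: "finite S" using S(1) fin by (rule finite_subset)
  \<comment> \<open>While \<open>S\<close> misses part of the component, some edge leaves
    \<open>S\<close>; otherwise \<open>S\<close> would be closed and contain the whole
    component.\<close>
  have "\<not> component E v \<subseteq> S" using Suc.prems S(3) card_mono[OF finS, of "component E v"] by auto
  then have "\<not> closed_under E S" using component_least[of E S v] S(2) by blast
  then obtain a b where ab: "a \<in> S" "b \<in> neighbours E a" "b \<notin> S" by (auto simp: closed_under_def)
  have "b \<in> component E v"
    using ab(1,2) S(1) closed_component[of E v] unfolding closed_under_def by blast
  moreover have "card (neighbours E b \<inter> S) \<ge> 1"
  proof -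
    have "a \<in> neighbours E b \<inter> S" using ab neighbours_sym by fast
    then have "card (neighbours E b \<inter> S) \<noteq> 0" using finS by (metis card_0_eq empty_iff finite_Int)
    then show ?thesis by simp
  qed
  ultimately have "insert b S \<subseteq> component E v \<and> v \<in> insert b S \<and> card (insert b S) = Suc (Suc j) \<and>
      Suc j \<le> card (inner_edges E (insert b S))"
    using S ab(3) finS inner_edges_insert[OF E ab(3)] by simp
  then show ?case by (rule exI)
qed

text \<open>The growth is run until it exhausts the component: a connected graph on \<open>m\<close>
  vertices has at least \<open>m - 1\<close> edges.\<close>

lemma card_component_le:
  assumes "edge_set E" "finite (component E v)"
  shows "card (component E v) \<le> card (inner_edges E (component E v)) + 1"
proof -
  have "card (component E v) \<noteq> 0" using assms(2) component_self by (metis card_0_eq empty_iff)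
  then obtain j where j: "card (component E v) = Suc j" by (cases "card (component E v)") auto
  obtain S where S: "S \<subseteq> component E v" "card S = Suc j" "j \<le> card (inner_edges E S)"
    using component_growth[OF assms, of j] j by auto
  then have "S = component E v" using j assms(2) by (simp add: card_subset_eq)
  then show ?thesis using S j by simp
qed

text \<open>The last vertex reached when a component is grown vertex by vertex is a leaf if the
  component has too few edges to contain a cycle.\<close>

lemma component_leaf:
  assumes E: "edge_set E" and fin: "finite (component E v)"
    and two: "2 \<le> card (component E v)"
    and few: "card (inner_edges E (component E v)) < card (component E v)"
  obtains a b where "a \<in> component E v" "neighbours E a = {b}"
proof -
  let ?C = "component E v"
  \<comment> \<open>The growth is stopped one vertex short of the full component; the missing vertex
    \<open>a\<close> is the leaf.\<close>
  define j where "j = card ?C - 2"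
  have j: "card ?C = Suc (Suc j)" using two by (simp add: j_def)
  have "\<exists>S \<subseteq> ?C. v \<in> S \<and> card S = Suc j \<and> j \<le> card (inner_edges E S)"
    by (rule component_growth[OF E fin]) (simp add: j)
  then obtain S where S: "S \<subseteq> ?C" "v \<in> S" "card S = Suc j" "j \<le> card (inner_edges E S)"
    by blast
  have finS: "finite S" using S(1) fin by (rule finite_subset)
  have "card (?C - S) = 1" using S j finS by (simp add: card_Diff_subset)
  then obtain a where a: "?C - S = {a}" by (metis card_1_singletonE)
  then have C: "?C = insert a S" "a \<notin> S" using S(1) by blast+
  have aC: "a \<in> ?C" by (simp add: C(1))
  then have nb: "neighbours E a \<subseteq> ?C" using closed_component[of E v] by (simp add: closed_under_def)
  have "a \<notin> neighbours E a" unfolding in_neighbours using edge_set_neq[OF E] by blast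
  then have "neighbours E a \<inter> S = neighbours E a" using nb unfolding C(1) by blast
  \<comment> \<open>The component has at most \<open>j + 1\<close> inner edges, and at least
    \<open>j\<close> of them lie in \<open>S\<close>.\<close>
  then have "card (neighbours E a) \<le> 1"
    using inner_edges_insert[OF E C(2)] few[unfolded j, unfolded C(1)] S(4) \<open>neighbours E a \<inter> S = neighbours E a\<close> by simp
  moreover have "neighbours E a \<noteq> {}"
  proof
    assume "neighbours E a = {}"
    then have "closed_under E {a}" by (simp add: closed_under_def)
    then have "component E a \<subseteq> {a}" by (rule component_least) simp
    moreover have "component E a = ?C" by (intro component_eq) (simp add: C(1))
    ultimately show False using C S(2) by blast
  qed
  ultimately have "card (neighbours E a) = 1"
    using finite_neighbours[OF E, of a] card_0_eq[of "neighbours E a"] by linarith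
  then obtain b where "neighbours E a = {b}" by (metis card_1_singletonE)
  then show ?thesis using that aC by blast
qed

lemma star_component:
  assumes E: "edge_set E" and leaves: "\<And>u. u \<in> neighbours E b \<Longrightarrow> neighbours E u \<subseteq> {b}"
  shows "component E b = insert b (neighbours E b)"
    and "\<And>e. e \<in> E \<Longrightarrow> e \<inter> component E b \<noteq> {} \<Longrightarrow> b \<in> e"
proof -
  have "closed_under E (insert b (neighbours E b))" using leaves by (auto simp: closed_under_def)
  then have "component E b \<subseteq> insert b (neighbours E b)" by (rule component_least) simp
  moreover have "insert b (neighbours E b) \<subseteq> component E b"
    using closed_component component_self unfolding closed_under_def by fast
  ultimately show eq: "component E b = insert b (neighbours E b)" by blast
  fix e assume e: "e \<in> E" "e \<inter> component E b \<noteq> {}"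
  then obtain p where p: "p \<in> e" "p \<in> insert b (neighbours E b)" using eq by auto
  obtain q where q: "e = {p, q}" "q \<in> neighbours E p" using edge_set_at[OF E e(1) p(1)] .
  show "b \<in> e"
  proof (cases "p = b")
    case False
    then have "q = b" using p(2) q leaves[of p] by blast
    then show ?thesis using q by simp
  qed (use p in simp)
qed

lemma disjoint_outer_edges:
  assumes "edge_set E" "closed_under E C"
  shows "C \<inter> \<Union>(E - inner_edges E C) = {}"
proof -
  have "e \<subseteq> C" if e: "e \<in> E" "p \<in> e" "p \<in> C" for e p
  proof -
    obtain q where "e = {p, q}" "q \<in> neighbours E p" using edge_set_at[OF assms(1) e(1,2)] .
    then show ?thesis using assms(2) e(3) unfolding closed_under_def by blast
  qed
  then show ?thesis by (auto simp: inner_edges_def)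
qed

section \<open>The lower bound\<close>

text \<open>Both saturation problems concern a property of graphs that lies between having a proper
  colouring without a rainbow copy of the smaller tree and having no copy of the larger one.\<close>

locale avoidance =
  fixes k :: nat and P :: "'a set set \<Rightarrow> bool"
  assumes k: "k \<ge> 4"
    and mono: "\<And>E F. P E \<Longrightarrow> F \<subseteq> E \<Longrightarrow> P F"
    and union: "\<And>E F. P E \<Longrightarrow> P F \<Longrightarrow> \<Union>E \<inter> \<Union>F = {} \<Longrightarrow> P (E \<union> F)"
    and if_rainbow: "\<And>E. edge_set E \<Longrightarrow> avoids_rainbow_T k E \<Longrightarrow> P E"
    and avoids: "\<And>E. edge_set E \<Longrightarrow> P E \<Longrightarrow> avoids_T (k + 1) E"
    and new_leaf: "\<And>E x y z. edge_set E \<Longrightarrow> P E \<Longrightarrow> x \<notin> \<Union>E \<Longrightarrow> x \<noteq> y \<Longrightarrow>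
      neighbours E y = {z} \<Longrightarrow> card (neighbours E z) \<le> k - 2 \<Longrightarrow> P (insert {x, y} E)"

text \<open>\<open>V\<close> is kept besides \<open>E\<close> because isolated vertices, invisible
  in \<open>E\<close>, matter for saturation.\<close>

locale saturated_avoidance = avoidance +
  fixes V :: "'a set" and E :: "'a set set"
  assumes finite_V: "finite V" and E: "edge_set E" "\<Union>E \<subseteq> V" and P: "P E"
    and sat: "\<And>x y. x \<in> V \<Longrightarrow> y \<in> V \<Longrightarrow> x \<noteq> y \<Longrightarrow> {x, y} \<notin> E \<Longrightarrow> \<not> P (insert {x, y} E)"
begin

lemma component_subset: "v \<in> V \<Longrightarrow> component E v \<subseteq> V"
  by (rule component_least) (use E(2) in \<open>auto simp: closed_under_def neighbours_def\<close>)

lemma finite_component: "v \<in> V \<Longrightarrow> finite (component E v)"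
  using component_subset finite_V finite_subset by metis

lemma neighbours_component: "a \<in> component E v \<Longrightarrow> b \<in> neighbours E a \<Longrightarrow> b \<in> component E v"
  using closed_component[of E v] unfolding closed_under_def by blast

lemma edge_set_inner: "edge_set (inner_edges E C)"
  using E(1) edge_set_subset[of E "inner_edges E C"] by (simp add: inner_edges_def)

text \<open>A new edge inside a union of components creates a copy there under every colouring of
  that part, since the remaining edges can keep their colours.\<close>

lemma not_avoids_rainbow_inner:
  assumes C: "C \<subseteq> V" "closed_under E C" and xy: "x \<in> C" "y \<in> C" "x \<noteq> y" "{x, y} \<notin> E"
  shows "\<not> avoids_rainbow_T k (insert {x, y} (inner_edges E C))"
proof
  assume a: "avoids_rainbow_T k (insert {x, y} (inner_edges E C))"
  have "P (insert {x, y} (inner_edges E C))"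
    by (rule if_rainbow[OF edge_set_insert[OF edge_set_inner xy(3)] a])
  moreover have "P (E - inner_edges E C)" by (rule mono[OF P]) blast
  moreover have "\<Union>(insert {x, y} (inner_edges E C)) \<subseteq> C"
    using xy by (auto simp: inner_edges_def)
  then have "\<Union>(insert {x, y} (inner_edges E C)) \<inter> \<Union>(E - inner_edges E C) = {}"
    using disjoint_outer_edges[OF E(1) C(2)] by blast
  ultimately have "P (insert {x, y} (inner_edges E C) \<union> (E - inner_edges E C))" by (rule union)
  moreover have "insert {x, y} (inner_edges E C) \<union> (E - inner_edges E C) = insert {x, y} E"
    by (auto simp: inner_edges_def)
  moreover have "x \<in> V" "y \<in> V" using xy C(1) by auto
  ultimately show False using sat xy by simp
qed

section \<open>The sizes of tree components\<close>

text \<open>In a tree component with three to \<open>k\<close> vertices, either a path on four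
  vertices starts at a leaf and can be closed to a 4-cycle, or the component is a star and two of
  its leaves can be joined. Neither forces a rainbow copy, against saturation.\<close>

lemma small_deficient_component:
  assumes v: "v \<in> V" and def: "card (inner_edges E (component E v)) < card (component E v)"
    and small: "card (component E v) \<le> k"
  shows "card (component E v) \<le> 2"
proof (rule ccontr)
  let ?C = "component E v"
  let ?E = "inner_edges E ?C"
  assume big: "\<not> card ?C \<le> 2"
  obtain a b where ab: "a \<in> ?C" "neighbours E a = {b}"
    using component_leaf[OF E(1) finite_component[OF v] _ def] big by auto
  have bC: "b \<in> ?C" using neighbours_component[OF ab(1)] ab(2) by blast
  have ba: "{b, a} \<in> E" using ab(2) by (auto simp: neighbours_def insert_commute)
  have edge: "{p, q} \<in> ?E" if "p \<in> ?C" "{p, q} \<in> E" for p q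
    using that neighbours_component[OF that(1), of q] by (simp add: inner_edges_def in_neighbours)
  note nonedge = not_avoids_rainbow_inner[OF component_subset[OF v] closed_component]
  show False
  proof (cases "\<exists>c d. {b, c} \<in> E \<and> {c, d} \<in> E \<and> c \<noteq> a \<and> d \<noteq> b")
    case True
    then obtain c d where cd: "{b, c} \<in> E" "{c, d} \<in> E" "c \<noteq> a" "d \<noteq> b" by metis
    have cC: "c \<in> ?C" using neighbours_component[OF bC] cd(1) by (simp add: in_neighbours)
    have dC: "d \<in> ?C" using neighbours_component[OF cC] cd(2) by (simp add: in_neighbours)
    have ad: "{a, d} \<notin> E" using ab(2) cd(4) by (auto simp: neighbours_def)
    have "c \<noteq> b" using edge_set_neq[OF E(1) cd(1)] by simp
    then have "a \<noteq> d" using ab(2) cd(2) by (auto simp: neighbours_def insert_commute)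
    have "neighbours ?E a = {b}"
      using ab edge[of a] by (auto simp: neighbours_def inner_edges_def)
    moreover have "card ?E \<le> k - 1" using def small by simp
    ultimately have "avoids_rainbow_T k (insert {a, d} ?E)"
      using avoids_rainbow_T_close_path[OF k edge_set_inner, of ?C a b c d] edge cd bC cC by simp
    then show False using nonedge[OF ab(1) dC \<open>a \<noteq> d\<close> ad] by simp
  next
    case False
    \<comment> \<open>No path on four vertices starts with \<open>a\<close>, \<open>b\<close>, so
      the component is a star with centre \<open>b\<close>.\<close>
    have leaves: "neighbours E u \<subseteq> {b}" if "u \<in> neighbours E b" for u
      using False that ab(2) unfolding neighbours_def by blast
    have Cb: "?C = insert b (neighbours E b)"
      using star_component(1)[OF E(1) leaves] component_eq[OF bC] by simp
    have star: "b \<in> e" if "e \<in> ?E" for e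
    proof (rule star_component(2)[OF E(1) leaves])
      show "e \<in> E" using that by (simp add: inner_edges_def)
      show "e \<inter> component E b \<noteq> {}"
        using that edge_setD(2)[OF edge_set_inner that] component_eq[OF bC]
        by (auto simp: inner_edges_def Int_absorb2)
    qed
    have fin: "finite (neighbours E b)" using finite_neighbours[OF E(1)] .
    have "card ?C \<le> Suc (card (neighbours E b))" unfolding Cb using fin
      by (simp add: card_insert_if)
    then have "2 \<le> card (neighbours E b)" using big by simp
    then obtain Y where Y: "Y \<subseteq> neighbours E b" "card Y = 2" by (meson obtain_subset_with_card_n)
    then obtain y z where yz: "{b, y} \<in> E" "{b, z} \<in> E" "y \<noteq> z"
      by (auto simp: card_2_iff neighbours_def)
    have yC: "y \<in> ?C" "z \<in> ?C" unfolding Cb using yz by (auto simp: neighbours_def)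
    have "{y, z} \<notin> E"
    proof
      assume "{y, z} \<in> E"
      then have "z = b" using leaves[of y] yz(1) by (auto simp: neighbours_def)
      then show False using edge_set_neq[OF E(1) yz(2)] by simp
    qed
    note no = nonedge[OF yC yz(3) this]
    have UC: "\<Union>(insert {y, z} ?E) \<subseteq> ?C" using yC by (auto simp: inner_edges_def)
    show False
    \<comment> \<open>A third leaf \<open>x\<close> lends the colour of its edge to the new edge.
      Without one there are at most three vertices, too few for any copy.\<close>
    proof (cases "\<exists>x. {b, x} \<in> E \<and> x \<noteq> y \<and> x \<noteq> z")
      case True
      then obtain x where x: "{b, x} \<in> E" "x \<noteq> y" "x \<noteq> z" by metis
      have "\<Union>?E \<subseteq> ?C" using UC by simp
      then have "card (\<Union>?E) \<le> k"
        using card_mono[OF finite_component[OF v], of "\<Union>?E"] small by simp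
      from avoids_rainbow_T_close_star[OF k edge_set_inner this star
          edge[OF bC x(1)] edge[OF bC yz(1)] edge[OF bC yz(2)] x(2,3) yz(3)]
      show False using no by simp
    next
      case False
      then have "?C \<subseteq> {b, y, z}" unfolding Cb by (auto simp: neighbours_def)
      then have "card (\<Union>(insert {y, z} ?E)) \<le> card {b, y, z}"
        using UC by (intro card_mono) auto
      also have "\<dots> < k" using k card_length[of "[b, y, z]"] by simp
      finally show False
        using no avoids_rainbow_T_few_vertices[OF k edge_set_insert[OF edge_set_inner yz(3)]] by simp
    qed
  qed
qed

text \<open>Joining two such components adds one edge to at most two disjoint ones. Two colours
  suffice for the result, whereas a rainbow copy needs \<open>k - 1 \<ge> 3\<close>.\<close>

lemma unique_tiny_component:
  assumes "v \<in> V" "w \<in> V" "card (component E v) \<le> 2" "card (component E w) \<le> 2"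
  shows "component E v = component E w"
proof (rule ccontr)
  let ?A = "component E v" and ?B = "component E w"
  assume ne: "?A \<noteq> ?B"
  have disj: "?A \<inter> ?B = {}" using component_disjoint[OF ne] .
  \<comment> \<open>An edge inside a component with at most two vertices fills it.\<close>
  have full: "e = component E u" if "u \<in> V" "card (component E u) \<le> 2" "e \<in> E" "e \<subseteq> component E u" for e u
    using that edge_setD(2)[OF E(1) that(3)] by (intro card_seteq) (auto intro: finite_component)
  have inner: "inner_edges E (?A \<union> ?B) \<subseteq> {?A, ?B}"
  proof
    fix e assume "e \<in> inner_edges E (?A \<union> ?B)"
    then have e: "e \<in> E" "e \<subseteq> ?A \<union> ?B" by (auto simp: inner_edges_def)
    obtain p q where pq: "e = {p, q}" using edge_setE[OF E(1) e(1)] .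
    then have q: "q \<in> neighbours E p" using e(1) by (simp add: neighbours_def)
    have "p \<in> ?A \<or> p \<in> ?B" using e(2) pq by auto
    then have "e \<subseteq> ?A \<or> e \<subseteq> ?B"
      using pq neighbours_component[OF _ q] by auto
    then show "e \<in> {?A, ?B}" using full[OF assms(1,3) e(1)] full[OF assms(2,4) e(1)] by auto
  qed
  have vw: "v \<in> ?A" "w \<in> ?B" "v \<notin> ?B" "w \<notin> ?A" using component_self disj by fast+
  have new: "{v, w} \<noteq> ?A" "{v, w} \<noteq> ?B" using vw by auto
  have "{v, w} \<notin> E"
    using neighbours_component[OF vw(1), of w] vw(4) by (auto simp: in_neighbours)
  moreover have "v \<noteq> w" using vw by auto
  moreover have "closed_under E (?A \<union> ?B)"
    using closed_component[of E v] closed_component[of E w] by (auto simp: closed_under_def)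
  ultimately have no: "\<not> avoids_rainbow_T k (insert {v, w} (inner_edges E (?A \<union> ?B)))"
    using component_subset[OF assms(1)] component_subset[OF assms(2)] vw
    by (intro not_avoids_rainbow_inner) auto
  let ?F = "insert {v, w} (inner_edges E (?A \<union> ?B))"
  define c :: "'a set \<Rightarrow> nat" where "c e = (if e = {v, w} then 1 else 0)" for e
  have "proper_col c ?F"
    unfolding proper_col_def
  proof (intro ballI impI notI)
    fix e e' assume e: "e \<in> ?F" "e' \<in> ?F" "e \<noteq> e' \<and> e \<inter> e' \<noteq> {}" "c e = c e'"
    then have "e \<noteq> {v, w}" "e' \<noteq> {v, w}" by (auto simp: c_def split: if_splits)
    then have "e \<in> {?A, ?B}" "e' \<in> {?A, ?B}" using e(1,2) inner by auto
    then show False using e(3) disj by auto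
  qed
  moreover have "card (c ` ?F) < k - 1"
  proof -
    have "card (c ` ?F) \<le> card {0, 1::nat}" by (intro card_mono) (auto simp: c_def)
    then show ?thesis using k by simp
  qed
  moreover have "finite ?F" using edge_setD(1)[OF edge_set_inner] by simp
  ultimately show False using no avoids_rainbow_T_few_colours[OF k] by blast
qed

text \<open>The absence of the larger tree, together with the impossibility of joining
  \<open>v\<close> to a leaf, forces the other component to be a star. Joining \<open>v\<close> to
  its centre then gives a larger star, which contains no copy at all.\<close>

lemma isolated_vertex:
  assumes "v \<in> V" "w \<in> V" and iso: "component E v = {v}"
    and def: "card (inner_edges E (component E w)) < card (component E w)"
    and big: "card (component E w) \<ge> k + 1"
  shows False
proof -
  let ?C = "component E w"
  obtain y z where yz: "y \<in> ?C" "neighbours E y = {z}"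
    using component_leaf[OF E(1) finite_component[OF assms(2)] _ def] big k by auto
  have vC: "v \<notin> ?C"
  proof
    assume "v \<in> ?C"
    then have "?C = {v}" using component_eq[of v E w] iso by simp
    then show False using big k by simp
  qed
  have vE: "v \<notin> \<Union>E"
  proof
    assume "v \<in> \<Union>E"
    then obtain e where e: "e \<in> E" "v \<in> e" by blast
    obtain q where "v \<noteq> q" "q \<in> neighbours E v" using edge_set_at[OF E(1) e] .
    then show False using neighbours_component[of v v q] iso by simp
  qed
  have zC: "z \<in> ?C" using neighbours_component[OF yz(1)] yz(2) by simp
  have nE: "{v, x} \<notin> E" for x using vE by blast
  have V: "y \<in> V" "z \<in> V" using yz(1) zC component_subset[OF assms(2)] by auto
  have "v \<noteq> y" "v \<noteq> z" using vC yz zC by auto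
  \<comment> \<open>A smaller degree would allow \<open>v\<close> to be joined to the leaf
    \<open>y\<close>.\<close>
  have deg: "card (neighbours E z) \<ge> k - 1"
  proof (rule ccontr)
    assume "\<not> ?thesis"
    then have "P (insert {v, y} E)"
      using new_leaf[OF E(1) P vE \<open>v \<noteq> y\<close> yz(2)] by simp
    then show False using sat[OF assms(1) V(1) \<open>v \<noteq> y\<close> nE] by simp
  qed
  have fin: "finite (neighbours E x)" for x using finite_neighbours[OF E(1)] .
  have z: "z \<notin> neighbours E z" unfolding in_neighbours using edge_set_neq[OF E(1)] by blast
  \<comment> \<open>A path \<open>z\<close>, \<open>u\<close>, \<open>x\<close> and
    \<open>k - 2\<close> spare neighbours of \<open>z\<close> form a copy of the larger
    tree.\<close>
  have noT: False
    if u: "u \<in> neighbours E z" "x \<in> neighbours E u" "x \<noteq> z" "card (neighbours E z - {u, x}) \<ge> k - 2" for u x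
  proof (rule avoids_TD_large[OF avoids[OF E(1) P]])
    have "u \<noteq> x" using u(2) edge_set_neq[OF E(1)] unfolding in_neighbours by blast
    then show "T_shape z u x (neighbours E z - {u, x})"
      using u z fin by (auto simp: T_shape_def)
    show "T_edges z u x (neighbours E z - {u, x}) \<subseteq> E"
      using u by (auto simp: T_edges_subset_iff in_neighbours)
    show "k + 1 - 3 \<le> card (neighbours E z - {u, x})" using u(4) by simp
  qed
  \<comment> \<open>If \<open>x\<close> lies outside the neighbourhood of \<open>z\<close>, all
    neighbours of \<open>z\<close> except \<open>u\<close> are spare, at least \<open>k - 2\<close>
    of them.\<close>
  have within: "neighbours E u \<subseteq> insert z (neighbours E z)" if "u \<in> neighbours E z" for u
  proof (rule ccontr)
    assume "\<not> ?thesis"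
    then obtain x where x: "x \<in> neighbours E u" "x \<noteq> z" "x \<notin> neighbours E z" by auto
    have "neighbours E z - {u, x} = neighbours E z - {u}" using x by auto
    then have "card (neighbours E z - {u, x}) = card (neighbours E z) - 1" using that by simp
    then show False using noT[OF that x(1,2)] deg by linarith
  qed
  have "closed_under E (insert z (neighbours E z))" using within by (simp add: closed_under_def subset_insertI)
  then have "component E z \<subseteq> insert z (neighbours E z)" by (rule component_least) simp
  then have "?C \<subseteq> insert z (neighbours E z)" using component_eq[OF zC] by simp
  then have "card ?C \<le> card (insert z (neighbours E z))" using fin by (intro card_mono) auto
  \<comment> \<open>The component has at least \<open>k + 1\<close> vertices, so \<open>z\<close>
    has \<open>k\<close> neighbours and two of them can now be given up.\<close>
  then have large: "card (neighbours E z) \<ge> k" using big fin z by simp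
  have leaves: "neighbours E u \<subseteq> {z}" if "u \<in> neighbours E z" for u
  proof
    fix x assume x: "x \<in> neighbours E u"
    have "card (neighbours E z - {u, x}) \<ge> card (neighbours E z) - card {u, x}"
      by (rule diff_card_le_card_Diff) simp
    moreover have "card {u, x} \<le> 2" by (simp add: card_insert_if)
    ultimately have "card (neighbours E z - {u, x}) \<ge> k - 2" using large by simp
    then show "x \<in> {z}" using noT[OF that x] by auto
  qed
  let ?D = "insert v ?C"
  have star: "z \<in> e" if "e \<in> insert {v, z} (inner_edges E ?D)" for e
  proof (cases "e = {v, z}")
    case False
    then have e: "e \<in> E" "e \<subseteq> ?D" using that by (auto simp: inner_edges_def)
    have "v \<notin> e" "e \<noteq> {}" using e(1) vE edge_setD(2)[OF E(1) e(1)] by auto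
    then have "e \<inter> component E z \<noteq> {}" using e(2) component_eq[OF zC] by auto
    then show ?thesis using star_component(2)[OF E(1) leaves e(1)] by simp
  qed simp
  have "closed_under E ?D"
  proof -
    have "neighbours E v = {}" using nE by (simp add: neighbours_def)
    then show ?thesis using closed_component[of E w] by (auto simp: closed_under_def)
  qed
  then have "\<not> avoids_rainbow_T k (insert {v, z} (inner_edges E ?D))"
    using component_subset[OF assms(2)] assms(1) zC \<open>v \<noteq> z\<close> nE
    by (intro not_avoids_rainbow_inner) auto
  then show False
    using avoids_rainbow_T_star[OF k edge_set_insert[OF edge_set_inner \<open>v \<noteq> z\<close>] star] by simp
qed

section \<open>Counting edges by components\<close>

lemma card_edges_ge:
  assumes V: "card V \<ge> 2"
  shows "card V - (card V + k - 1) div (k + 1) \<le> card E"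
proof -
  define \<C> where "\<C> = component E ` V"
  \<comment> \<open>By \<open>card_component_le\<close> no component lacks more than one edge
    against its vertices, so these are the trees and each costs exactly one edge.\<close>
  define \<D> where "\<D> = {C \<in> \<C>. card (inner_edges E C) < card C}"
  have fin: "finite \<C>" "finite \<D>" using finite_V by (auto simp: \<C>_def \<D>_def)
  have finC: "finite C" if "C \<in> \<C>" for C using that finite_component by (auto simp: \<C>_def)
  have disj: "C \<inter> C' = {}" if C: "C \<in> \<C>" "C' \<in> \<C>" "C \<noteq> C'" for C C'
  proof -
    obtain u v where "C = component E u" "C' = component E v" using C(1,2) by (auto simp: \<C>_def)
    then show ?thesis using component_disjoint[of E u v] C(3) by simp
  qed
  have DC: "C \<in> \<C>" if "C \<in> \<D>" for C using that by (simp add: \<D>_def)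
  have UV: "\<Union>\<C> = V" using component_subset component_self by (fastforce simp: \<C>_def)
  have cardV: "card V = (\<Sum>C\<in>\<C>. card C)"
    unfolding UV[symmetric] using disj finC by (intro card_Union_disjoint) (auto simp: pairwise_def disjnt_def)
  have cardE: "card E = (\<Sum>C\<in>\<C>. card (inner_edges E C))"
  proof -
    have "E = (\<Union>C\<in>\<C>. inner_edges E C)"
    proof
      show "E \<subseteq> (\<Union>C\<in>\<C>. inner_edges E C)"
      proof
        fix e assume e: "e \<in> E"
        obtain p q where pq: "e = {p, q}" using edge_setE[OF E(1) e] .
        then have "q \<in> component E p"
          using neighbours_component[OF component_self, of q p] e by (simp add: in_neighbours)
        then have "e \<subseteq> component E p" using pq component_self by simp
        moreover have "p \<in> V" using e pq E(2) by auto
        ultimately show "e \<in> (\<Union>C\<in>\<C>. inner_edges E C)" using e by (auto simp: inner_edges_def \<C>_def)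
      qed
    qed (auto simp: inner_edges_def)
    moreover have "card (\<Union>C\<in>\<C>. inner_edges E C) = (\<Sum>C\<in>\<C>. card (inner_edges E C))"
    proof (rule card_UN_disjoint[OF fin(1)])
      show "\<forall>C\<in>\<C>. finite (inner_edges E C)" using edge_setD(1)[OF edge_set_inner] by blast
      show "\<forall>C\<in>\<C>. \<forall>C'\<in>\<C>. C \<noteq> C' \<longrightarrow> inner_edges E C \<inter> inner_edges E C' = {}"
      proof (intro ballI impI)
        fix C C' assume "C \<in> \<C>" "C' \<in> \<C>" "C \<noteq> C'"
        then have d: "C \<inter> C' = {}" by (rule disj)
        show "inner_edges E C \<inter> inner_edges E C' = {}"
        proof (rule ccontr)
          assume "inner_edges E C \<inter> inner_edges E C' \<noteq> {}"
          then obtain e where "e \<in> E" "e \<subseteq> C \<inter> C'" by (auto simp: inner_edges_def)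
          then show False using d edge_setD(2)[OF E(1), of e] by auto
        qed
      qed
    qed
    ultimately show ?thesis by simp
  qed
  have "card V \<le> (\<Sum>C\<in>\<C>. card (inner_edges E C) + (if C \<in> \<D> then 1 else 0))"
    unfolding cardV
  proof (rule sum_mono)
    fix C assume "C \<in> \<C>"
    then show "card C \<le> card (inner_edges E C) + (if C \<in> \<D> then 1 else 0)"
      using card_component_le[OF E(1)] finite_component by (auto simp: \<C>_def \<D>_def)
  qed
  also have "\<dots> = card E + card \<D>"
  proof -
    have "(\<Sum>C\<in>\<C>. if C \<in> \<D> then 1 else 0) = card (\<C> \<inter> \<D>)"
      using fin by (simp add: sum.If_cases)
    moreover have "\<C> \<inter> \<D> = \<D>" by (auto simp: \<D>_def)
    ultimately show ?thesis by (simp add: sum.distrib cardE)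
  qed
  finally have main: "card V \<le> card E + card \<D>" .
  have dich: "card C \<le> 2 \<or> k + 1 \<le> card C" if C: "C \<in> \<D>" for C
  proof -
    obtain v where "v \<in> V" "C = component E v" "card (inner_edges E C) < card C"
      using C by (auto simp: \<C>_def \<D>_def)
    then show ?thesis using small_deficient_component[of v] by force
  qed
  have "(k + 1) * card \<D> \<le> card V + k - 1"
  proof (cases "card \<D> \<le> 1")
    case True
    then have "(k + 1) * card \<D> \<le> (k + 1) * 1" by (rule mult_le_mono2)
    \<comment> \<open>The right-hand side is at least \<open>k + 1\<close> because
      \<open>card V \<ge> 2\<close>.\<close>
    then show ?thesis using V by simp
  next
    case False
    have le: "(\<Sum>C\<in>\<D>. card C) \<le> card V"
      unfolding cardV by (rule sum_mono2[OF fin(1)]) (auto simp: \<D>_def)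
    show ?thesis
    proof (cases "\<exists>C\<in>\<D>. card C \<le> 2")
      case True
      then obtain C where C: "C \<in> \<D>" "card C \<le> 2" by blast
      obtain v where v: "v \<in> V" "C = component E v" using C(1) by (auto simp: \<C>_def \<D>_def)
      have others: "k + 1 \<le> card C'" if C': "C' \<in> \<D> - {C}" for C'
      proof -
        obtain w where w: "w \<in> V" "C' = component E w" using C' by (auto simp: \<C>_def \<D>_def)
        then have "\<not> card C' \<le> 2" using unique_tiny_component[OF v(1) w(1)] C(2) v(2) C' by auto
        then show ?thesis using dich[of C'] C' by simp
      qed
      have "\<D> - {C} \<noteq> {}" using False by (metis Diff_eq_empty_iff card_mono card.empty card_insert_disjoint empty_iff finite.emptyI finite_insert One_nat_def)
      then obtain C' where C': "C' \<in> \<D> - {C}" by blast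
      obtain w where w: "w \<in> V" "C' = component E w" "card (inner_edges E C') < card C'"
        using C' by (auto simp: \<C>_def \<D>_def)
      \<comment> \<open>The second tree, necessarily large, excludes an isolated vertex.\<close>
      have "card C \<noteq> 1"
      proof
        assume "card C = 1"
        then have "component E v = {v}" using v(2) component_self[of v E] by (auto simp: card_1_singleton_iff)
        then show False using isolated_vertex[OF v(1) w(1)] w(2,3) others[OF C'] by simp
      qed
      moreover have "card C \<noteq> 0" using finC[OF DC[OF C(1)]] v(2) component_self[of v E] by auto
      \<comment> \<open>Two vertices here and \<open>k + 1\<close> in every other tree give
        \<open>card V \<ge> 2 + (k + 1) * (t - 1)\<close> for \<open>t\<close> trees, that is,
        \<open>(k + 1) * t \<le> card V + k - 1\<close>.\<close>
      ultimately have "card C = 2" using C(2) by linarith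
      moreover have "(\<Sum>C\<in>\<D>. card C) = card C + (\<Sum>C\<in>\<D> - {C}. card C)"
        using fin(2) C(1) by (rule sum.remove)
      moreover have "(\<Sum>C\<in>\<D> - {C}. card C) \<ge> card (\<D> - {C}) * (k + 1)"
        using sum_bounded_below[of "\<D> - {C}" "k + 1" card] others by simp
      moreover have "card \<D> = Suc (card (\<D> - {C}))" using card_Suc_Diff1[OF fin(2) C(1)] by (rule sym)
      ultimately show ?thesis using le by (simp add: algebra_simps)
    next
      case none: False
      have "card \<D> * (k + 1) \<le> (\<Sum>C\<in>\<D>. card C)"
        using sum_bounded_below[of \<D> "k + 1" card] dich none by fastforce
      then have "(k + 1) * card \<D> \<le> card V" using le by (simp add: mult.commute)
      then show ?thesis using k by linarith
    qed
  qed
  then have "card \<D> \<le> (card V + k - 1) div (k + 1)"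
    by (simp add: less_eq_div_iff_mult_less_eq mult.commute)
  then show ?thesis using main by linarith
qed

end

section \<open>The two saturation problems as instances\<close>

text \<open>Here \<open>if_rainbow\<close> is \<open>avoids_rainbow_TD\<close> and
  \<open>avoids\<close> is trivial; for \<open>avoids_rainbow_T\<close> it is the other way
  round.\<close>

lemma avoidance_T: "k \<ge> 4 \<Longrightarrow> avoidance k (avoids_T (k + 1))"
  by unfold_locales
    (auto intro: avoids_T_mono avoids_T_union avoids_T_new_leaf avoids_rainbow_TD simp del: One_nat_def add_Suc_right)

lemma avoidance_rainbow_T: "k \<ge> 4 \<Longrightarrow> avoidance k (avoids_rainbow_T k)"
  by unfold_locales
    (auto intro: avoids_rainbow_T_mono avoids_rainbow_T_union avoids_rainbow_T_new_leaf avoids_rainbow_TD simp del: One_nat_def add_Suc_right)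

lemma card_edges_ge_if_saturated:
  assumes "avoidance k P" "simple_graph G" "card (verts G) = n" "n \<ge> 2"
    and "P (edges G)" "\<forall>e\<in>non_edges G. \<not> P (insert e (edges G))"
  shows "n - (n + k - 1) div (k + 1) \<le> card (edges G)"
proof -
  interpret avoidance k P by fact
  interpret saturated_avoidance k P "verts G" "edges G"
  proof
    show "edge_set (edges G)" "finite (verts G)" "\<Union>(edges G) \<subseteq> verts G"
      using assms(2) simple_graph_edge_set by (auto simp: simple_graph_def)
    fix x y assume "x \<in> verts G" "y \<in> verts G" "x \<noteq> y" "{x, y} \<notin> edges G"
    then have "{x, y} \<in> non_edges G" by (simp add: non_edges_def)
    then show "\<not> P (insert {x, y} (edges G))" using assms(6) by blast
  qed (fact assms(5))
  show ?thesis using card_edges_ge assms(3,4) by simp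
qed

section \<open>The extremal graph\<close>

text \<open>A disjoint union of stars, given by the map \<open>f\<close> that sends every vertex to the centre of
  its star. Its sole small component is the single edge \<open>{0, 1}\<close>.\<close>

locale star_forest =
  fixes k :: nat and V :: "nat set" and f :: "nat \<Rightarrow> nat"
  assumes k: "k \<ge> 4" and finite_V: "finite V" and f_in: "\<And>v. v \<in> V \<Longrightarrow> f v \<in> V"
    and idem: "\<And>v. v \<in> V \<Longrightarrow> f (f v) = f v"
    and tiny: "{v \<in> V. f v = 0} = {0, 1}"
    and large: "\<And>a. a \<in> V \<Longrightarrow> f a = a \<Longrightarrow> a \<noteq> 0 \<Longrightarrow> k \<le> card {v \<in> V. v \<noteq> a \<and> f v = a}"
begin

text \<open>The fixed points of \<open>f\<close> are the centres of the stars.\<close>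

definition forest :: "nat set set" where
  "forest = (\<lambda>v. {v, f v}) ` {v \<in> V. f v \<noteq> v}"

lemma zero: "0 \<in> V" "1 \<in> V" "f 0 = 0" "f 1 = 0"
  using tiny by auto

lemma edge_forest: "{x, y} \<in> forest \<longleftrightarrow>
    x \<in> V \<and> y \<in> V \<and> x \<noteq> y \<and> (f x = y \<or> f y = x)"
  using f_in by (fastforce simp: forest_def doubleton_eq_iff)

lemma simple_graph_forest: "simple_graph (SGraph V forest)"
  using finite_V f_in by (auto simp: simple_graph_def forest_def card_insert_if)

lemma card_forest: "card forest = card V - card {v \<in> V. f v = v}"
proof -
  \<comment> \<open>An edge reveals its non-central end: \<open>f v\<close> is a fixed point while
    \<open>v\<close> is not.\<close>
  have "inj_on (\<lambda>v. {v, f v}) {v \<in> V. f v \<noteq> v}"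
    using idem by (auto simp: inj_on_def doubleton_eq_iff)
  then have "card forest = card {v \<in> V. f v \<noteq> v}" unfolding forest_def by (rule card_image)
  also have "{v \<in> V. f v \<noteq> v} = V - {v \<in> V. f v = v}" by auto
  also have "card \<dots> = card V - card {v \<in> V. f v = v}" using finite_V by (intro card_Diff_subset) auto
  finally show ?thesis .
qed

text \<open>In a copy the adjacent vertices \<open>v\<close> and \<open>u\<close> both have two
  neighbours. In the forest such vertices are centres, and no two centres are adjacent.\<close>

lemma avoids_rainbow_T_forest: "avoids_rainbow_T k forest"
proof (rule avoids_rainbow_T_if_no_T)
  show "edge_set forest" using simple_graph_edge_set[OF simple_graph_forest] by simp
  show "avoids_T k forest"
    unfolding avoids_T_def
  proof (intro notI, elim exE conjE)
    fix v u w L assume T: "T_shape v u w L" "card L = k - 3" "T_edges v u w L \<subseteq> forest"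
    have "L \<noteq> {}" using T(2) k by auto
    then obtain l where "l \<in> L" by blast
    then have ne: "v \<noteq> w" "u \<noteq> l" and e: "{v, u} \<in> forest" "{u, w} \<in> forest" "{v, l} \<in> forest"
      using T(1,3) by (auto simp: T_shape_def T_edges_subset_iff)
    have hub: "f x = x" if "{x, y} \<in> forest" "{x, z} \<in> forest" "y \<noteq> z" for x y z
      using that idem unfolding edge_forest by metis
    have "f v = v" using hub[OF e(1,3) ne(2)] .
    moreover have "f u = u" using hub[of u v w] e(1,2) ne(1) by (simp add: insert_commute)
    ultimately show False using e(1) unfolding edge_forest by auto
  qed
qed

text \<open>If \<open>x\<close> is a centre, the copy is centred at \<open>x\<close> and runs
  through \<open>y\<close> to a neighbour of \<open>y\<close>. If \<open>x\<close> is a leaf, the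
  copy is centred at \<open>f x\<close> and runs through \<open>x\<close> to
  \<open>y\<close>.\<close>

lemma contains_T_if_large_star:
  assumes xy: "x \<in> V" "y \<in> V" "x \<noteq> y" "{x, y} \<notin> forest" and x: "f x \<noteq> 0"
  shows "\<not> avoids_T (k + 1) (insert {x, y} forest)"
proof
  assume no: "avoids_T (k + 1) (insert {x, y} forest)"
  define F where "F = {v \<in> V. v \<noteq> f x \<and> f v = f x}"
  have fin: "finite F" using finite_V by (simp add: F_def)
  have cardF: "k \<le> card F"
    unfolding F_def using large[OF f_in[OF xy(1)] idem[OF xy(1)] x] .
  have F: "{f x, a} \<in> forest" if "a \<in> F" for a
    using that f_in[OF xy(1)] by (auto simp: F_def edge_forest)
  have fx: "f x \<notin> F" by (simp add: F_def)
  \<comment> \<open>At most two of the \<open>k\<close> leaves are lost to the path, which leaves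
    the required \<open>k - 2\<close>.\<close>
  have len: "k + 1 - 3 \<le> card (F - {p, q})" for p q
  proof -
    have "card F - card {p, q} \<le> card (F - {p, q})" by (rule diff_card_le_card_Diff) simp
    moreover have "card {p, q} \<le> 2" by (simp add: card_insert_if)
    ultimately show ?thesis using cardF by linarith
  qed
  show False
  proof (cases "f x = x")
    case True
    have yx: "f y \<noteq> x" using xy True unfolding edge_forest by auto
    \<comment> \<open>Every vertex of the forest has a neighbour, since no star is a single vertex.
      It lies in the star of \<open>y\<close>, hence differs from \<open>x\<close>.\<close>
    obtain y' where y': "{y, y'} \<in> forest" "f y' = f y"
    proof (cases "f y = y")
      case False
      then show ?thesis using that[of "f y"] idem xy(2) f_in by (simp add: edge_forest)
    next
      case fy: True
      show ?thesis
      proof (cases "y = 0")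
        case True
        then show ?thesis using that[of 1] zero by (simp add: edge_forest)
      next
        case False
        then have "card {v \<in> V. v \<noteq> y \<and> f v = y} \<noteq> 0" using large[OF xy(2) fy] k by linarith
        then have "{v \<in> V. v \<noteq> y \<and> f v = y} \<noteq> {}" by (metis card.empty)
        then obtain z where "z \<in> V" "z \<noteq> y" "f z = y" by blast
        then show ?thesis using that[of z] fy xy(2) by (simp add: edge_forest)
      qed
    qed
    have ne: "y \<noteq> y'" "x \<noteq> y'" using y' True yx by (auto simp: edge_forest)
    have "T_shape x y y' (F - {y, y'})"
      using ne xy(3) fin fx True by (auto simp: T_shape_def)
    moreover have "T_edges x y y' (F - {y, y'}) \<subseteq> insert {x, y} forest"
      using y'(1) F True by (auto simp: T_edges_subset_iff)
    ultimately show False using avoids_TD_large[OF no _ len] by blast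
  next
    case False
    have "y \<noteq> f x" using xy False by (auto simp: edge_forest)
    then have "T_shape (f x) x y (F - {x, y})"
      using False xy(3) fin fx by (auto simp: T_shape_def)
    moreover have "T_edges (f x) x y (F - {x, y}) \<subseteq> insert {x, y} forest"
      using F False xy(1) by (auto simp: T_edges_subset_iff F_def)
    ultimately show False using avoids_TD_large[OF no _ len] by blast
  qed
qed

text \<open>The star on \<open>0\<close> and \<open>1\<close> is complete, so every non-edge has an
  end in a large star.\<close>

lemma not_avoids_T_add_edge:
  assumes "e \<in> non_edges (SGraph V forest)"
  shows "\<not> avoids_T (k + 1) (insert e forest)"
proof -
  obtain x y where e: "e = {x, y}" "x \<noteq> y" using assms by (auto simp: non_edges_def card_2_iff)
  then have xy: "x \<in> V" "y \<in> V" "{x, y} \<notin> forest" using assms by (auto simp: non_edges_def)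
  have "f x \<noteq> 0 \<or> f y \<noteq> 0"
  proof (rule ccontr)
    assume "\<not> ?thesis"
    then have "x \<in> {0, 1}" "y \<in> {0, 1}" using tiny xy by auto
    then show False using xy(3) e(2) zero by (auto simp: edge_forest)
  qed
  then show ?thesis
    using contains_T_if_large_star[of x y] contains_T_if_large_star[of y x] xy e
    by (auto simp: insert_commute)
qed

end

section \<open>Construction of the forest for given \<open>n\<close>\<close>

text \<open>After \<open>0\<close> and \<open>1\<close>, the vertices are cut into blocks of
  \<open>k + 1\<close> consecutive numbers whose first elements are the centres.\<close>

lemma exists_star_forest:
  assumes k: "k \<ge> 4" and n: "n \<ge> k + 3"
  obtains f where "star_forest k {..<n} f"
    "card {v \<in> {..<n}. f v = v} = (n + k - 1) div (k + 1)"
proof -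
  define p where "p = (n - 2) div (k + 1)"
  \<comment> \<open>The minimum attaches the vertices left over after \<open>p\<close> full blocks
    to the last star.\<close>
  define f where "f v = (if v < 2 then 0 else 2 + (k + 1) * min (p - 1) ((v - 2) div (k + 1)))" for v
  \<comment> \<open>The assumption \<open>n \<ge> k + 3\<close> makes room for one full
    block.\<close>
  have p: "p \<ge> 1" "(k + 1) * p \<le> n - 2"
    using n div_le_mono[of "k + 1" "n - 2" "k + 1"] by (simp_all add: p_def del: One_nat_def)
  have f_centre: "f (2 + (k + 1) * i + j) = 2 + (k + 1) * i" if "i < p" "j \<le> k" for i j
  proof -
    have "((k + 1) * i + j) div (k + 1) = i" using that(2) by (intro div_nat_eqI) auto
    then show ?thesis using that(1) by (simp add: f_def del: mult_Suc mult_Suc_right)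
  qed
  have f_cases: "f v = 0 \<or> (\<exists>i<p. f v = 2 + (k + 1) * i)" for v
    using p(1) by (auto simp: f_def intro!: exI[of _ "min (p - 1) ((v - 2) div (k + 1))"])
  have block: "2 + (k + 1) * i + j < n" if "i < p" "j \<le> k" for i j
  proof -
    have "(k + 1) * (i + 1) \<le> (k + 1) * p" using that(1) by (intro mult_le_mono2) simp
    then have "(k + 1) * i + (k + 1) \<le> n - 2" using p(2) by (simp add: algebra_simps)
    then show ?thesis using that(2) n by linarith
  qed
  have f0: "f 0 = 0" by (simp add: f_def)
  have forest: "star_forest k {..<n} f"
  proof
    show "4 \<le> k" by fact
    show "finite {..<n}" by simp
    show "f v \<in> {..<n}" if "v \<in> {..<n}" for v
      using f_cases[of v] block[of _ 0] n by auto
    show "f (f v) = f v" if "v \<in> {..<n}" for v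
      using f_cases[of v] f_centre[of _ 0] f0 by auto
    show "{v \<in> {..<n}. f v = 0} = {0, 1}" using n by (auto simp: f_def)
    fix a assume a: "a \<in> {..<n}" "f a = a" "a \<noteq> 0"
    then obtain i where i: "i < p" "a = 2 + (k + 1) * i" using f_cases[of a] by auto
    have "(\<lambda>j. a + j) ` {1..k} \<subseteq> {v \<in> {..<n}. v \<noteq> a \<and> f v = a}"
      using block[OF i(1)] f_centre[OF i(1)] i(2) by auto
    then have "card ((\<lambda>j. a + j) ` {1..k}) \<le> card {v \<in> {..<n}. v \<noteq> a \<and> f v = a}"
      by (intro card_mono) auto
    then show "k \<le> card {v \<in> {..<n}. v \<noteq> a \<and> f v = a}" by (simp add: card_image)
  qed
  have "{v \<in> {..<n}. f v = v} = insert 0 ((\<lambda>i. 2 + (k + 1) * i) ` {..<p})"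
  proof
    show "{v \<in> {..<n}. f v = v} \<subseteq> insert 0 ((\<lambda>i. 2 + (k + 1) * i) ` {..<p})"
    proof
      fix v assume "v \<in> {v \<in> {..<n}. f v = v}"
      then show "v \<in> insert 0 ((\<lambda>i. 2 + (k + 1) * i) ` {..<p})" using f_cases[of v] by auto
    qed
    show "insert 0 ((\<lambda>i. 2 + (k + 1) * i) ` {..<p}) \<subseteq> {v \<in> {..<n}. f v = v}"
      using f_centre[of _ 0] block[of _ 0] f0 n by auto
  qed
  moreover have "card (insert 0 ((\<lambda>i. 2 + (k + 1) * i) ` {..<p})) = Suc p"
  proof -
    have "inj_on (\<lambda>i. 2 + (k + 1) * i) {..<p}"
      by (rule inj_onI) (simp only: add_left_cancel mult_cancel1 add_is_0, simp)
    then have "card ((\<lambda>i. 2 + (k + 1) * i) ` {..<p}) = p" by (simp only: card_image card_lessThan)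
    moreover have "0 \<notin> (\<lambda>i. 2 + (k + 1) * i) ` {..<p}" by auto
    ultimately show ?thesis by (metis card_insert_disjoint finite_imageI finite_lessThan)
  qed
  \<comment> \<open>The \<open>p\<close> large stars and the edge \<open>{0, 1}\<close> make
    \<open>p + 1\<close> stars; adding \<open>k + 1\<close> to \<open>n - 2\<close> raises the
    quotient by one accordingly.\<close>
  moreover have "(n + k - 1) div (k + 1) = Suc p"
  proof -
    have "n + k - 1 = (n - 2) + (k + 1)" using n by simp
    then show ?thesis unfolding p_def by (metis add.commute div_add_self1 plus_1_eq_Suc add_is_0 one_neq_zero)
  qed
  ultimately show ?thesis using that forest by simp
qed

theorem theorem6p1:
  fixes k n :: nat
  assumes "k \<ge> 4" and "n \<ge> k + 3"
  shows "proper_rainbow_sat n (T_star k) = sat n (T_star (k + 1)) \<and>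
         sat n (T_star (k + 1)) = n - (n + k - 1) div (k + 1)"
proof -
  let ?m = "n - (n + k - 1) div (k + 1)"
  obtain f where f: "star_forest k {..<n} f" "card {v \<in> {..<n}. f v = v} = (n + k - 1) div (k + 1)"
    using exists_star_forest[OF assms] .
  interpret star_forest k "{..<n}" f by fact
  let ?G = "SGraph {..<n} forest"
  have G: "simple_graph ?G" "card (verts ?G) = n" "card (edges ?G) = ?m"
    using simple_graph_forest card_forest f(2) by simp_all
  have n: "n \<ge> 2" and k1: "k + 1 \<ge> 4" using assms by simp_all
  note TD = avoids_rainbow_TD[OF assms(1)]
  \<comment> \<open>The forest serves both problems: \<open>avoids_rainbow_TD\<close> turns its
    rainbow-free colouring into the absence of the larger tree, and a copy of the larger tree after
    adding an edge into the failure of every proper colouring.\<close>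
  have "saturated (T_star (k + 1)) ?G"
    unfolding saturated_iff[OF G(1) k1] using TD[OF avoids_rainbow_T_forest] not_avoids_T_add_edge by simp
  then have "sat n (T_star (k + 1)) = ?m"
    unfolding sat_def
    using G card_edges_ge_if_saturated[OF avoidance_T[OF assms(1)] _ _ n] saturated_iff[OF _ k1]
    by (intro Least_equality) blast+
  moreover have "properly_rainbow_saturated (T_star k) ?G"
    unfolding properly_rainbow_saturated_iff[OF G(1) assms(1)]
    using avoids_rainbow_T_forest not_avoids_T_add_edge TD by auto
  then have "proper_rainbow_sat n (T_star k) = ?m"
    unfolding proper_rainbow_sat_def
    using G card_edges_ge_if_saturated[OF avoidance_rainbow_T[OF assms(1)] _ _ n]
      properly_rainbow_saturated_iff[OF _ assms(1)]
    by (intro Least_equality) blast+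
  ultimately show ?thesis by simp
qed

end
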